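(* Let $K$ be a field, let $n>1$ be an integer and $A=\{t_1^n\}$, and let $B_1=\{m_1,\ldots,m_6\}$ be a configuration with exactly $6$ elements whose toric ideal is $I_{B_1}=\langle z_1z_2z_3-z_4z_5z_6\rangle\subset K[z_1,\ldots,z_6]$. Then there is a monomial order on $K[\mathbf{x}]$ with respect to which the toric ideal $I_{A(B_1)}$ of the nested configuration $A(B_1)$ has a quadratic Gröbner basis consisting of all the following binomials, the initial monomial of each being its first (underlined) monomial: (i) $\underline{x_{j_1j_2M_1}\,x_{j_3M_2}}-x_{j_4j_5M_1}\,x_{j_6M_2}$, where $\{j_1,j_2,j_3\}=\{1,2,3\}$ and $\{j_4,j_5,j_6\}=\{4,5,6\}$ (and $M_1$, $M_2$ are strings over $\{1,\ldots,6\}$ of lengths $n-2$, $n-1$); (ii) $\underline{x_{j_1\cdots j_n}\,x_{j_{n+1}\cdots j_{2n}}}-x_{1\cdots1\,j'_1\cdots j'_\alpha}\,x_{1\cdots1\,j'_{\alpha+1}\cdots j'_{2\alpha}}$, where $\mathrm{sort}(j_1\cdots j_{2n})=1\cdots1\,j'_1\cdots j'_{2\alpha}$ (with $2(n-\alpha)$ leading $1$'s, $n-\alpha$ of which are put in each of the two labels) and $j'_2>1$.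
   Context: A configuration of a polynomial ring $K[u_1,\ldots,u_\mu]$ is a finite set of distinct monomials $\mathbf{u}^{\mathbf{b}}$ such that there is $\mathbf{w}\in\mathbb{R}^\mu$ with $\mathbf{w}\cdot\mathbf{b}=1$ for all exponent vectors $\mathbf{b}$ of the set. The toric ideal $I_{B_1}$ is the kernel of $K[z_1,\ldots,z_6]\to K[\mathbf{u}]$, $z_i\mapsto m_i$. For $A=\{t_1^n\}$ the nested configuration is $A(B_1)=\{m_{j_1}\cdots m_{j_n}:1\le j_1,\ldots,j_n\le6\}$ (as a set of monomials). $K[\mathbf{x}]$ has one variable for each element of $A(B_1)$, and $x_{j_1\cdots j_n}$ denotes the variable corresponding to $m_{j_1}\cdots m_{j_n}$ (so the order of the letters in a label is immaterial, and labels giving the same monomial denote the same variable). $I_{A(B_1)}$ is the kernel of $x_{j_1\cdots j_n}\mapsto m_{j_1}\cdots m_{j_n}$. A label is standard if it does not contain all three of the letters $1,2,3$ (i.e. $z_{j_1}\cdots z_{j_n}$ is not divisible by $z_1z_2z_3$); every variable has exactly one standard label up to order. In the underlined monomials each variable is written with its standard label; labels in the second monomials may be arbitrary. $\mathrm{sort}$ rearranges a string of letters from $\{1,\ldots,6\}$ into weakly increasing order. Expressions of type (ii) in which the two monomials coincide (giving $0$) are discarded. A Gröbner basis is quadratic if its initial monomials are quadratic. *)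

theory Defs
  imports Complex_Main "HOL-Library.Poly_Mapping" "HOL-Algebra.RingHom"
begin

text \<open>
  A monomial in variables of type \<open>'x\<close> is its exponent vector, of type \<open>'x \<Rightarrow>\<^sub>0 nat\<close>, so the
  product of monomials is written \<open>+\<close> and the monomial 1 is \<open>0\<close>. A polynomial is a finitely
  supported map from monomials to coefficients, and \<open>Poly_Mapping.keys p\<close> is the set of monomials
  occurring in \<open>p\<close>. The polynomial ring over a set \<open>X\<close> of variables is the subring of the polynomials in
  which only variables from \<open>X\<close> occur.
\<close>

type_synonym 'x mono = "'x \<Rightarrow>\<^sub>0 nat"
type_synonym ('x, 'k) mpoly = "'x mono \<Rightarrow>\<^sub>0 'k"

definition monomials :: "'x set \<Rightarrow> 'x mono set" where
  "monomials X = {t. Poly_Mapping.keys t \<subseteq> X}"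

definition mono_degree :: "'x mono \<Rightarrow> nat" where
  "mono_degree t = (\<Sum>v\<in>Poly_Mapping.keys t. Poly_Mapping.lookup t v)"

definition mono_poly :: "'x mono \<Rightarrow> ('x, 'k::comm_ring_1) mpoly" where
  "mono_poly t = Poly_Mapping.single t 1"

definition mono_var :: "'x \<Rightarrow> 'x mono" where
  "mono_var v = Poly_Mapping.single v 1"

definition var :: "'x \<Rightarrow> ('x, 'k::comm_ring_1) mpoly" where
  "var v = mono_poly (mono_var v)"

definition poly_ring :: "'x set \<Rightarrow> ('x, 'k::comm_ring_1) mpoly ring" where
  "poly_ring X = \<lparr>carrier = {p. Poly_Mapping.keys p \<subseteq> monomials X},
     mult = (*), one = 1, zero = 0, add = (+)\<rparr>"

lemma cring_poly_ring: "cring (poly_ring X :: ('x, 'k::comm_ring_1) mpoly ring)"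
proof (rule cringI)
  have keys_plus: "Poly_Mapping.keys (p + q) \<subseteq> monomials X"
    if "Poly_Mapping.keys p \<subseteq> monomials X" "Poly_Mapping.keys q \<subseteq> monomials X"
    for p q :: "('x, 'k) mpoly"
    using that keys_add[of p q] by blast
  have monomials_add: "s \<in> monomials X \<Longrightarrow> t \<in> monomials X \<Longrightarrow> s + t \<in> monomials X" for s t
    using keys_add[of s t] by (auto simp: monomials_def)
  have keys_times: "Poly_Mapping.keys (p * q) \<subseteq> monomials X"
    if "Poly_Mapping.keys p \<subseteq> monomials X" "Poly_Mapping.keys q \<subseteq> monomials X"
    for p q :: "('x, 'k) mpoly"
    using that keys_mult[of p q] monomials_add by blast
  show "abelian_group (poly_ring X :: ('x, 'k) mpoly ring)"
  proof (rule abelian_groupI)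
    fix p :: "('x, 'k) mpoly"
    assume "p \<in> carrier (poly_ring X)"
    then show "\<exists>q\<in>carrier (poly_ring X). q \<oplus>\<^bsub>poly_ring X\<^esub> p = \<zero>\<^bsub>poly_ring X\<^esub>"
      by (intro bexI[of _ "- p"]) (auto simp: poly_ring_def)
  qed (auto simp: poly_ring_def keys_plus[THEN subsetD] algebra_simps)
  show "comm_monoid (poly_ring X :: ('x, 'k) mpoly ring)"
    by (rule comm_monoidI)
      (auto simp: poly_ring_def keys_times[THEN subsetD] algebra_simps, simp add: monomials_def)
qed (simp add: poly_ring_def algebra_simps)

text \<open>The \<open>K\<close>-algebra homomorphism that sends the variable \<open>v\<close> to \<open>f v\<close>.\<close>

definition poly_subst ::
    "('x \<Rightarrow> ('u, 'k) mpoly) \<Rightarrow> ('x, 'k::comm_ring_1) mpoly \<Rightarrow> ('u, 'k) mpoly" where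
  "poly_subst f p = (\<Sum>t\<in>Poly_Mapping.keys p.
     Poly_Mapping.single 0 (Poly_Mapping.lookup p t) *
     (\<Prod>v\<in>Poly_Mapping.keys t. f v ^ Poly_Mapping.lookup t v))"

text \<open>The kernel of \<open>K[X] \<rightarrow> K[U]\<close>, where the variable \<open>v\<close> is sent to the monomial \<open>\<phi> v\<close>.\<close>

definition toric_ideal ::
    "'u set \<Rightarrow> 'x set \<Rightarrow> ('x \<Rightarrow> 'u mono) \<Rightarrow> ('x, 'k::comm_ring_1) mpoly set" where
  "toric_ideal U X \<phi> = a_kernel (poly_ring X) (poly_ring U) (poly_subst (\<lambda>v. mono_poly (\<phi> v)))"

definition configuration :: "nat \<Rightarrow> nat mono set \<Rightarrow> bool" where
  "configuration \<mu> B \<longleftrightarrow> finite B \<and> B \<subseteq> monomials {1..\<mu>} \<and>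
     (\<exists>w :: nat \<Rightarrow> real. \<forall>b\<in>B. (\<Sum>i=1..\<mu>. w i * real (Poly_Mapping.lookup b i)) = 1)"

text \<open>The nested configuration \<open>A(B)\<close> for \<open>A = {t\<^sub>1\<^sup>n}\<close>: all products of \<open>n\<close> elements of \<open>B\<close>.\<close>

definition nested_configuration :: "nat \<Rightarrow> 'u mono set \<Rightarrow> 'u mono set" where
  "nested_configuration n B = {sum_list bs | bs. length bs = n \<and> set bs \<subseteq> B}"

text \<open>Total orders, as relations \<open>(s, t) \<in> r\<close> for \<open>s \<le> t\<close>, on the monomials in the variables \<open>X\<close>.\<close>

definition monomial_order :: "'x set \<Rightarrow> 'x mono rel \<Rightarrow> bool" where
  "monomial_order X r \<longleftrightarrow> linear_order_on (monomials X) r \<and>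
     (\<forall>t\<in>monomials X. (0, t) \<in> r) \<and>
     (\<forall>s\<in>monomials X. \<forall>t\<in>monomials X. \<forall>u\<in>monomials X. (s, t) \<in> r \<longrightarrow> (s + u, t + u) \<in> r)"

text \<open>The initial monomial is only meaningful for nonzero polynomials.\<close>

definition initial_mono :: "'x mono rel \<Rightarrow> ('x, 'k::zero) mpoly \<Rightarrow> 'x mono" where
  "initial_mono r p = (THE t. t \<in> Poly_Mapping.keys p \<and> (\<forall>s\<in>Poly_Mapping.keys p. (s, t) \<in> r))"

definition initial_ideal ::
    "'x set \<Rightarrow> 'x mono rel \<Rightarrow> ('x, 'k::comm_ring_1) mpoly set \<Rightarrow> ('x, 'k) mpoly set" where
  "initial_ideal X r I = Idl\<^bsub>poly_ring X\<^esub> {mono_poly (initial_mono r f) | f. f \<in> I \<and> f \<noteq> 0}"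

definition groebner_basis ::
    "'x set \<Rightarrow> 'x mono rel \<Rightarrow> ('x, 'k::comm_ring_1) mpoly set \<Rightarrow> ('x, 'k) mpoly set \<Rightarrow> bool" where
  "groebner_basis X r I G \<longleftrightarrow> finite G \<and> G \<subseteq> I \<and> 0 \<notin> G \<and>
     Idl\<^bsub>poly_ring X\<^esub> {mono_poly (initial_mono r g) | g. g \<in> G} = initial_ideal X r I"

definition quadratic_groebner_basis ::
    "'x set \<Rightarrow> 'x mono rel \<Rightarrow> ('x, 'k::comm_ring_1) mpoly set \<Rightarrow> ('x, 'k) mpoly set \<Rightarrow> bool" where
  "quadratic_groebner_basis X r I G \<longleftrightarrow> groebner_basis X r I G \<and>
     (\<forall>g\<in>G. mono_degree (initial_mono r g) = 2)"

text \<open>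
  The variables of \<open>K[x]\<close> are the elements of the nested configuration themselves. Hence a label
  (a list of letters from \<open>{1..6}\<close>) denotes the variable given by the product of the \<open>m j\<close>, and
  labels with the same product denote the same variable.
\<close>

definition label_var :: "(nat \<Rightarrow> 'u mono) \<Rightarrow> nat list \<Rightarrow> 'u mono" where
  "label_var m js = sum_list (map m js)"

definition label_mono :: "(nat \<Rightarrow> 'u mono) \<Rightarrow> nat list \<Rightarrow> 'u mono mono" where
  "label_mono m js = mono_var (label_var m js)"

definition standard_label :: "nat list \<Rightarrow> bool" where
  "standard_label js \<longleftrightarrow> \<not> {1, 2, 3} \<subseteq> set js"

text \<open>A pair \<open>(s, t)\<close> of monomials of \<open>K[x]\<close> stands for the expression \<open>s - t\<close> with \<open>s\<close> underlined.\<close>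

definition binomials_i :: "nat \<Rightarrow> (nat \<Rightarrow> 'u mono) \<Rightarrow> ('u mono mono \<times> 'u mono mono) set" where
  "binomials_i n m =
     {(label_mono m ([j1, j2] @ M1) + label_mono m (j3 # M2),
       label_mono m ([j4, j5] @ M1) + label_mono m (j6 # M2)) | j1 j2 j3 j4 j5 j6 M1 M2.
      {j1, j2, j3} = {1, 2, 3} \<and> {j4, j5, j6} = {4, 5, 6} \<and>
      length M1 = n - 2 \<and> length M2 = n - 1 \<and> set M1 \<subseteq> {1..6} \<and> set M2 \<subseteq> {1..6} \<and>
      standard_label ([j1, j2] @ M1) \<and> standard_label (j3 # M2)}"

text \<open>
  Here \<open>L1 = j\<^sub>1\<dots>j\<^sub>n\<close>, \<open>L2 = j\<^sub>n\<^sub>+\<^sub>1\<dots>j\<^sub>2\<^sub>n\<close> and \<open>J = j'\<^sub>1\<dots>j'\<^sub>2\<^sub>\<alpha>\<close>; as lists are indexed from 0, \<open>j'\<^sub>2\<close> is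
  \<open>J ! 1\<close>. If all letters are 1 there is no \<open>j'\<^sub>2\<close>; that case would only give the expression 0,
  so \<open>\<alpha> \<ge> 1\<close> is required.
\<close>

definition binomials_ii :: "nat \<Rightarrow> (nat \<Rightarrow> 'u mono) \<Rightarrow> ('u mono mono \<times> 'u mono mono) set" where
  "binomials_ii n m =
     {(s, t). s \<noteq> t \<and> (\<exists>L1 L2 J \<alpha>.
        length L1 = n \<and> length L2 = n \<and> set L1 \<subseteq> {1..6} \<and> set L2 \<subseteq> {1..6} \<and>
        standard_label L1 \<and> standard_label L2 \<and>
        1 \<le> \<alpha> \<and> \<alpha> \<le> n \<and> length J = 2 * \<alpha> \<and>
        sort (L1 @ L2) = replicate (2 * (n - \<alpha>)) 1 @ J \<and> J ! 1 > 1 \<and>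
        s = label_mono m L1 + label_mono m L2 \<and>
        t = label_mono m (replicate (n - \<alpha>) 1 @ take \<alpha> J) +
            label_mono m (replicate (n - \<alpha>) 1 @ drop \<alpha> J))}"

definition binomial_poly :: "'x mono \<times> 'x mono \<Rightarrow> ('x, 'k::comm_ring_1) mpoly" where
  "binomial_poly = (\<lambda>(s, t). mono_poly s - mono_poly t)"

end

theory Submission
  imports Defs "HOL-Library.Multiset"
begin

text \<open>
  Order monomials first by the total number of letters 1, 2, 3 in standard labels, then by the sum of
  squares of the numbers of ones, then by the negated sum of squares of the letter sums. Type (i)
  replaces 1, 2, 3 by 4, 5, 6; type (ii) does this as well if it produces a nonstandard label, and
  otherwise balances the ones and sorts the rest; so every first monomial is initial.

  A monomial divisible by no first monomial has, for every two of its labels, no common occurrence of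
  1, 2, 3, and the two are balanced and sorted. Then the labels are totally ordered, and the first of
  them is determined by the product of all labels. That product avoids 1, 2 or 3, so it is
  determined by its image in \<open>K[u]\<close>. Hence distinct such monomials have distinct images, and in a
  nonzero element of the toric ideal the initial monomial, which must share its image with a
  smaller monomial, is divisible by some first monomial.
\<close>

subsection \<open>Additive maps on monomials\<close>

text \<open>The delicate point is the degree. Divisibility by a first monomial inspects two
  variables at a time, whereas the relation \<open>z1 z2 z3 - z4 z5 z6\<close> is cubic: the letters
  1, 2, 3 could sit in three different labels, and no pair of labels would reveal them. The special
  role of the letter 1 in type (ii) prevents this. The ones are spread evenly over all labels, and
  for \<open>n > 1\<close> this forces 1, 2, 3 to meet in some pair of labels as soon as all three
  occur. The other letters are not spread but cut at one place; hence the two lower levels of the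
  order pull in opposite directions, one preferring small and the other large sums of squares. No
  S-pairs are computed. It suffices that every replacement lowers a weight in the natural numbers,
  and that each fibre of the monomial map contains at most one monomial to which no replacement
  applies.\<close>

definition mono_eval :: "('x \<Rightarrow> 'a::comm_monoid_add) \<Rightarrow> 'x mono \<Rightarrow> 'a" where
  "mono_eval f t = (\<Sum>v\<in>Poly_Mapping.keys t. \<Sum>i<Poly_Mapping.lookup t v. f v)"

text \<open>\<open>mono_eval\<close> takes values in an arbitrary commutative monoid (numbers,
  monomials, multisets of letters), so multiples are written as sums of equal terms.\<close>

lemma sum_const_lessThan_add:
  "(\<Sum>i<a + b. c) = (\<Sum>i<a. c) + (\<Sum>i<b. c :: 'a::comm_monoid_add)" for a b :: nat
  by (induction b) (simp_all only: add_0_right add_Suc_right sum.lessThan_Suc add.assoc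
      lessThan_0 sum.empty)

lemma mono_eval_superset:
  assumes "finite A" "Poly_Mapping.keys t \<subseteq> A"
  shows "mono_eval f t = (\<Sum>v\<in>A. \<Sum>i<Poly_Mapping.lookup t v. f v)"
  unfolding mono_eval_def
  by (rule sum.mono_neutral_left) (use assms in \<open>auto simp: in_keys_iff\<close>)

lemma mono_eval_add: "mono_eval f (s + t) = mono_eval f s + mono_eval f t"
proof -
  let ?A = "Poly_Mapping.keys s \<union> Poly_Mapping.keys t"
  have "mono_eval f r = (\<Sum>v\<in>?A. \<Sum>i<Poly_Mapping.lookup r v. f v)"
    if "Poly_Mapping.keys r \<subseteq> ?A" for r
    using that by (intro mono_eval_superset) auto
  then show ?thesis
    using keys_add[of s t]
    by (simp only: lookup_add sum_const_lessThan_add sum.distrib[symmetric] Un_upper1 Un_upper2)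
qed

lemma mono_eval_0 [simp]: "mono_eval f 0 = 0"
  by (simp add: mono_eval_def)

lemma mono_eval_mono_var [simp]: "mono_eval f (mono_var v) = f v"
  by (simp add: mono_eval_def mono_var_def)

lemma mono_degree_eq_mono_eval: "mono_degree t = mono_eval (\<lambda>_. 1) t"
  by (simp add: mono_degree_def mono_eval_def)

lemma keys_mono_var [simp]: "Poly_Mapping.keys (mono_var v) = {v}"
  by (simp add: mono_var_def)

lemma mono_var_inject: "mono_var v = mono_var w \<longleftrightarrow> v = w"
  by (metis keys_mono_var singleton_inject)

lemma keys_add_nat: "Poly_Mapping.keys (s + t) = Poly_Mapping.keys s \<union> Poly_Mapping.keys t"
  for s t :: "'x mono"
  by (auto simp: in_keys_iff lookup_add)

lemma monomials_add_iff: "s + t \<in> monomials X \<longleftrightarrow> s \<in> monomials X \<and> t \<in> monomials X"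
  by (simp add: monomials_def keys_add_nat)

lemma mono_var_in_monomials: "mono_var v \<in> monomials X \<longleftrightarrow> v \<in> X"
  by (simp add: monomials_def)

lemma mono_split:
  assumes "v \<in> Poly_Mapping.keys t"
  obtains t' where "t = mono_var v + t'"
proof
  show "t = mono_var v + (t - mono_var v)"
    using assms
    by (intro poly_mapping_eqI) (auto simp: lookup_add lookup_minus mono_var_def lookup_single in_keys_iff when_def)
qed

lemma mono_induct [case_names zero add]:
  assumes "P 0" "\<And>v t. P t \<Longrightarrow> P (mono_var v + t)"
  shows "P t"
proof (induction "mono_degree t" arbitrary: t rule: less_induct)
  case less
  show ?case
  proof (cases "t = 0")
    case False
    then obtain v where "v \<in> Poly_Mapping.keys t"
      by (metis all_not_in_conv in_keys_iff lookup_zero poly_mapping_eqI)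
    then obtain t' where t: "t = mono_var v + t'"
      by (rule mono_split)
    then show ?thesis
      using less assms(2)[of t' v] by (simp add: mono_degree_eq_mono_eval mono_eval_add)
  qed (use assms in simp)
qed

lemma mono_var_add_eq_iff:
  "mono_var a + mono_var b = mono_var c + mono_var d \<longleftrightarrow> a = c \<and> b = d \<or> a = d \<and> b = c"
proof
  assume eq: "mono_var a + mono_var b = mono_var c + mono_var d"
  then have "a \<in> {c, d}"
    by (metis insertI1 keys_add_nat keys_mono_var insert_is_Un)
  then show "a = c \<and> b = d \<or> a = d \<and> b = c"
    using eq by (auto simp: mono_var_inject add.commute[of "mono_var c"] dest: add_left_imp_eq)
qed (auto simp: add.commute)

lemma mono_poly_add: "mono_poly (s + t) = mono_poly s * mono_poly t"
  by (simp add: mono_poly_def mult_single)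

subsection \<open>Toric ideals\<close>

text \<open>The homomorphism of monoid algebras induced by \<open>mono_eval \<phi>\<close>. Unlike
  substitution, this form shows directly which terms can cancel.\<close>

definition push_poly :: "('x \<Rightarrow> 'a::comm_monoid_add) \<Rightarrow> ('x, 'k) mpoly \<Rightarrow> ('a \<Rightarrow>\<^sub>0 'k::comm_ring_1)"
  where "push_poly \<phi> p =
    (\<Sum>t\<in>Poly_Mapping.keys p. Poly_Mapping.single (mono_eval \<phi> t) (Poly_Mapping.lookup p t))"

lemma push_poly_superset:
  assumes "finite A" "Poly_Mapping.keys p \<subseteq> A"
  shows "push_poly \<phi> p = (\<Sum>t\<in>A. Poly_Mapping.single (mono_eval \<phi> t) (Poly_Mapping.lookup p t))"
  unfolding push_poly_def
  by (rule sum.mono_neutral_left) (use assms in \<open>auto simp: in_keys_iff\<close>)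

lemma push_poly_add: "push_poly \<phi> (p + q) = push_poly \<phi> p + push_poly \<phi> q"
  for p q :: "('x, 'k::comm_ring_1) mpoly"
proof -
  let ?A = "Poly_Mapping.keys p \<union> Poly_Mapping.keys q"
  have "push_poly \<phi> r = (\<Sum>t\<in>?A. Poly_Mapping.single (mono_eval \<phi> t) (Poly_Mapping.lookup r t))"
    if "Poly_Mapping.keys r \<subseteq> ?A" for r :: "('x, 'k) mpoly"
    using that by (intro push_poly_superset) auto
  then show ?thesis
    using keys_add[of p q]
    by (simp only: lookup_add single_add sum.distrib[symmetric] Un_upper1 Un_upper2)
qed

lemma push_poly_0 [simp]: "push_poly \<phi> 0 = 0"
  by (simp add: push_poly_def)

lemma push_poly_uminus: "push_poly \<phi> (- p) = - push_poly \<phi> p"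
  using push_poly_add[of \<phi> p "- p"] by (simp add: add_eq_0_iff)

lemma push_poly_diff: "push_poly \<phi> (p - q) = push_poly \<phi> p - push_poly \<phi> q"
  using push_poly_add[of \<phi> p "- q"] by (simp add: push_poly_uminus)

lemma push_poly_sum: "push_poly \<phi> (sum f A) = (\<Sum>a\<in>A. push_poly \<phi> (f a))"
  by (induction A rule: infinite_finite_induct) (simp_all add: push_poly_add)

lemma push_poly_single:
  "push_poly \<phi> (Poly_Mapping.single t c) = Poly_Mapping.single (mono_eval \<phi> t) c"
  by (simp add: push_poly_def)

lemma mpoly_eq_sum_single:
  "p = (\<Sum>t\<in>Poly_Mapping.keys p. Poly_Mapping.single t (Poly_Mapping.lookup p t))"
proof (rule poly_mapping_eqI)
  fix u
  show "Poly_Mapping.lookup p u = Poly_Mapping.lookup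
     (\<Sum>t\<in>Poly_Mapping.keys p. Poly_Mapping.single t (Poly_Mapping.lookup p t)) u"
    by (simp add: lookup_sum lookup_single when_def sum.delta in_keys_iff)
qed

lemma push_poly_mult: "push_poly \<phi> (p * q) = push_poly \<phi> p * push_poly \<phi> q"
proof -
  have "p * q = (\<Sum>s\<in>Poly_Mapping.keys p. \<Sum>t\<in>Poly_Mapping.keys q.
      Poly_Mapping.single (s + t) (Poly_Mapping.lookup p s * Poly_Mapping.lookup q t))"
    by (subst mult_single[symmetric], subst sum_product[symmetric])
      (simp only: mpoly_eq_sum_single[symmetric])
  then have "push_poly \<phi> (p * q) = (\<Sum>s\<in>Poly_Mapping.keys p. \<Sum>t\<in>Poly_Mapping.keys q.
      Poly_Mapping.single (mono_eval \<phi> s + mono_eval \<phi> t)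
        (Poly_Mapping.lookup p s * Poly_Mapping.lookup q t))"
    by (simp only: push_poly_sum push_poly_single mono_eval_add)
  also have "\<dots> = push_poly \<phi> p * push_poly \<phi> q"
    by (simp only: push_poly_def sum_product mult_single)
  finally show ?thesis .
qed

lemma push_poly_mono_poly: "push_poly \<phi> (mono_poly t) = Poly_Mapping.single (mono_eval \<phi> t) 1"
  by (simp add: mono_poly_def push_poly_single)

lemma push_poly_binomial_eq_0_iff:
  "push_poly \<phi> (mono_poly s - mono_poly t :: ('x, 'k::comm_ring_1) mpoly) = 0
    \<longleftrightarrow> mono_eval \<phi> s = mono_eval \<phi> t"
  by (metis eq_iff_diff_eq_0 push_poly_diff push_poly_mono_poly lookup_single_eq
      lookup_single_not_eq zero_neq_one)

lemma poly_subst_mono_poly: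
  fixes \<phi> :: "'x \<Rightarrow> 'u mono" and p :: "('x, 'k::comm_ring_1) mpoly"
  shows "poly_subst (\<lambda>v. mono_poly (\<phi> v)) p = push_poly \<phi> p"
proof -
  have pow: "mono_poly (a :: 'u mono) ^ k = (mono_poly (\<Sum>i<k. a) :: ('u, 'k) mpoly)" for a k
    by (induction k)
      (simp_all only: power_0 power_Suc2 sum.lessThan_Suc mono_poly_add lessThan_0 sum.empty,
        simp add: mono_poly_def)
  have "(\<Prod>v\<in>A. mono_poly (f v)) = (mono_poly (sum f A) :: ('u, 'k) mpoly)"
    if "finite A" for A :: "'x set" and f :: "'x \<Rightarrow> 'u mono"
    using that by (induction A) (simp_all add: mono_poly_add, simp add: mono_poly_def)
  note prod = this[OF finite_keys]
  have "(\<Prod>v\<in>Poly_Mapping.keys t. mono_poly (\<phi> v) ^ Poly_Mapping.lookup t v) =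
      (mono_poly (mono_eval \<phi> t) :: ('u, 'k) mpoly)" for t
    unfolding pow prod mono_eval_def ..
  then show ?thesis
    by (simp add: poly_subst_def push_poly_def mono_poly_def mult_single)
qed

lemma mem_toric_ideal_iff:
  "p \<in> toric_ideal U X \<phi> \<longleftrightarrow> Poly_Mapping.keys p \<subseteq> monomials X \<and> push_poly \<phi> p = 0"
  by (simp add: toric_ideal_def a_kernel_def' poly_subst_mono_poly poly_ring_def)

lemma carrier_poly_ring: "carrier (poly_ring X) = {p. Poly_Mapping.keys p \<subseteq> monomials X}"
  by (simp add: poly_ring_def)

lemma keys_mono_poly: "Poly_Mapping.keys (mono_poly t :: ('x, 'k::comm_ring_1) mpoly) = {t}"
  by (simp add: mono_poly_def)

lemma keys_binomial:
  assumes "s \<noteq> t"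
  shows "Poly_Mapping.keys (binomial_poly (s, t) :: ('x, 'k::comm_ring_1) mpoly) = {s, t}"
  using assms by (auto simp: binomial_poly_def mono_poly_def in_keys_iff lookup_minus lookup_single when_def
      split: if_splits)

lemma lookup_push_poly:
  "Poly_Mapping.lookup (push_poly \<phi> p) c =
    (\<Sum>t\<in>{t \<in> Poly_Mapping.keys p. mono_eval \<phi> t = c}. Poly_Mapping.lookup p t)"
  by (auto simp: push_poly_def lookup_sum lookup_single when_def sum.If_cases Int_def conj_commute
      intro!: sum.cong)

text \<open>The coefficients over each fibre of \<open>mono_eval \<phi>\<close> add up to zero, so
  no term is alone in its fibre.\<close>

lemma push_poly_eq_0D:
  assumes "push_poly \<phi> p = 0" "t \<in> Poly_Mapping.keys p"
  obtains u where "u \<in> Poly_Mapping.keys p" "u \<noteq> t" "mono_eval \<phi> u = mono_eval \<phi> t"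
proof (rule ccontr)
  assume "\<not> thesis"
  with that have "{u \<in> Poly_Mapping.keys p. mono_eval \<phi> u = mono_eval \<phi> t} = {t}"
    using assms(2) by auto
  then have "Poly_Mapping.lookup (push_poly \<phi> p) (mono_eval \<phi> t) = Poly_Mapping.lookup p t"
    by (simp add: lookup_push_poly)
  then show False
    using assms by (simp add: in_keys_iff)
qed

text \<open>Elements of a principal ideal are multiples of its generator. As \<phi> is free, the
  kernel of one monomial map can be tested with another one.\<close>

lemma push_poly_Idl_single:
  assumes "p \<in> Idl\<^bsub>poly_ring X\<^esub> {g :: ('x, 'k::comm_ring_1) mpoly}"
    and "Poly_Mapping.keys g \<subseteq> monomials X" and "push_poly \<phi> g = 0"
  shows "push_poly \<phi> p = 0"
proof -
  interpret cring "poly_ring X :: ('x, 'k) mpoly ring"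
    by (rule cring_poly_ring)
  have "p \<in> PIdl\<^bsub>poly_ring X\<^esub> g"
    using assms cgenideal_eq_genideal[of g] by (simp add: carrier_poly_ring)
  then obtain q where "p = q * g"
    by (auto simp: cgenideal_def poly_ring_def)
  then show ?thesis
    using assms(3) by (simp add: push_poly_mult)
qed

subsection \<open>Groebner bases of toric ideals\<close>

text \<open>The tie-breaker is the lexicographic order on finitely supported functions. It makes the
  order total; the first monomials are singled out by \<omega> alone.\<close>

definition weight_order :: "('x::linorder) set \<Rightarrow> ('x \<Rightarrow> nat) \<Rightarrow> 'x mono rel" where
  "weight_order X \<omega> = {(s, t). s \<in> monomials X \<and> t \<in> monomials X \<and>
     (mono_eval \<omega> s < mono_eval \<omega> t \<or> mono_eval \<omega> s = mono_eval \<omega> t \<and> s \<le> t)}"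

lemma mono_nonneg: "0 \<le> t" for t :: "('x::linorder) mono"
proof (induction t rule: mono_induct)
  case (add v t)
  have "(0::'x mono) \<le> mono_var v"
    unfolding mono_var_def by transfer (auto simp: less_fun_def when_def)
  then show ?case
    using add by (rule add_nonneg_nonneg)
qed simp

lemma monomial_order_weight_order: "monomial_order X (weight_order X \<omega>)"
  unfolding monomial_order_def
proof (intro conjI ballI impI)
  show "linear_order_on (monomials X) (weight_order X \<omega>)"
    by (auto simp: linear_order_on_def partial_order_on_def preorder_on_def refl_on_def
        total_on_def weight_order_def intro!: antisymI transI)
next
  fix t assume "t \<in> monomials X"
  then show "(0, t) \<in> weight_order X \<omega>"
    using mono_nonneg[of t] by (auto simp: weight_order_def monomials_def)
next
  fix s t u
  assume "u \<in> monomials X" "(s, t) \<in> weight_order X \<omega>"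
  then show "(s + u, t + u) \<in> weight_order X \<omega>"
    by (auto simp: weight_order_def mono_eval_add monomials_add_iff add_right_mono)
qed

section \<open>Initial monomials and irreducible monomials\<close>

lemma initial_mono_eqI:
  assumes "monomial_order X r" "Poly_Mapping.keys p \<subseteq> monomials X"
    and "t \<in> Poly_Mapping.keys p" "\<And>s. s \<in> Poly_Mapping.keys p \<Longrightarrow> (s, t) \<in> r"
  shows "initial_mono r p = t"
proof -
  have "antisym r"
    using assms(1) by (simp add: monomial_order_def linear_order_on_def partial_order_on_def)
  then show ?thesis
    unfolding initial_mono_def using assms by (intro the_equality) (auto dest: antisymD)
qed

lemma linear_order_has_max:
  assumes "linear_order_on A r" "finite B" "B \<noteq> {}" "B \<subseteq> A"
  shows "\<exists>t\<in>B. \<forall>s\<in>B. (s, t) \<in> r"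
  using assms(2-)
proof (induction B rule: finite_ne_induct)
  case (singleton x)
  then show ?case
    using assms(1) by (auto simp: linear_order_on_def partial_order_on_def preorder_on_def refl_on_def)
next
  case (insert x B)
  then obtain t where t: "t \<in> B" "\<forall>s\<in>B. (s, t) \<in> r"
    by auto
  have r: "refl_on A r" "trans r" "total_on A r"
    using assms(1) by (auto simp: linear_order_on_def partial_order_on_def preorder_on_def)
  have "(x, t) \<in> r \<or> (t, x) \<in> r"
    using r insert.prems t(1) by (cases "x = t") (auto simp: refl_on_def total_on_def)
  moreover have "(x, x) \<in> r"
    using r insert.prems by (auto simp: refl_on_def)
  ultimately show ?case
    using t r(2) by (auto dest: transD)
qed

lemma initial_mono_max:
  assumes "monomial_order X r" "Poly_Mapping.keys p \<subseteq> monomials X" "p \<noteq> 0"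
  shows "initial_mono r p \<in> Poly_Mapping.keys p"
    and "s \<in> Poly_Mapping.keys p \<Longrightarrow> (s, initial_mono r p) \<in> r"
proof -
  have "Poly_Mapping.keys p \<noteq> {}"
    using assms(3) by (metis all_not_in_conv in_keys_iff lookup_zero poly_mapping_eqI)
  then obtain t where "t \<in> Poly_Mapping.keys p" "\<forall>s\<in>Poly_Mapping.keys p. (s, t) \<in> r"
    using linear_order_has_max[of "monomials X" r "Poly_Mapping.keys p"] assms
    by (auto simp: monomial_order_def)
  moreover from this have "initial_mono r p = t"
    using assms by (intro initial_mono_eqI) auto
  ultimately show "initial_mono r p \<in> Poly_Mapping.keys p"
    and "s \<in> Poly_Mapping.keys p \<Longrightarrow> (s, initial_mono r p) \<in> r"
    by auto
qed

definition irreducible_mono :: "('x mono \<times> 'x mono) set \<Rightarrow> 'x mono \<Rightarrow> bool" where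
  "irreducible_mono P t \<longleftrightarrow> (\<forall>(a, b)\<in>P. \<forall>u. t \<noteq> a + u)"

lemma irreducible_monoD: "irreducible_mono P (a + u) \<Longrightarrow> (a, b) \<notin> P"
  by (auto simp: irreducible_mono_def)

text \<open>Replacing a factor \<open>s\<close> by \<open>t\<close> keeps the image and lowers the
  weight, so the process stops. The last disjunct allows a comparison with other monomials of the
  fibre.\<close>

lemma ex_irreducible_mono:
  assumes P: "\<And>s t. (s, t) \<in> P \<Longrightarrow> t \<in> monomials X \<and>
      mono_eval \<phi> s = mono_eval \<phi> t \<and> mono_eval \<omega> t < (mono_eval \<omega> s :: nat)"
    and "u \<in> monomials X"
  shows "\<exists>u'\<in>monomials X. irreducible_mono P u' \<and> mono_eval \<phi> u' = mono_eval \<phi> u \<and>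
    (u' = u \<or> mono_eval \<omega> u' < mono_eval \<omega> u)"
  using assms(2)
proof (induction "mono_eval \<omega> u" arbitrary: u rule: less_induct)
  case less
  show ?case
  proof (cases "irreducible_mono P u")
    case False
    then obtain s t w where st: "(s, t) \<in> P" and u: "u = s + w"
      by (auto simp: irreducible_mono_def)
    note P[OF st]
    moreover from this have "mono_eval \<omega> (t + w) < mono_eval \<omega> u" "t + w \<in> monomials X"
      using less.prems by (auto simp: u mono_eval_add monomials_add_iff)
    ultimately show ?thesis
      using less.hyps[of "t + w"] by (auto simp: u mono_eval_add intro: less_trans)
  qed (use less in blast)
qed

text \<open>This takes the place of Buchberger's criterion: the S-pair test becomes the uniqueness
  of irreducible monomials within a fibre.\<close>

theorem groebner_basis_toric_ideal:
  fixes P :: "(('x::linorder) mono \<times> 'x mono) set" and \<phi> :: "'x \<Rightarrow> 'u mono"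
  defines "G \<equiv> binomial_poly ` P :: ('x, 'k::field) mpoly set"
  assumes "finite P"
    and P: "\<And>s t. (s, t) \<in> P \<Longrightarrow> s \<in> monomials X \<and> t \<in> monomials X \<and>
      mono_eval \<phi> s = mono_eval \<phi> t \<and> mono_eval \<omega> t < mono_eval \<omega> s"
    and unique: "\<And>s t. s \<in> monomials X \<Longrightarrow> t \<in> monomials X \<Longrightarrow> irreducible_mono P s \<Longrightarrow>
      irreducible_mono P t \<Longrightarrow> mono_eval \<phi> s = mono_eval \<phi> t \<Longrightarrow> s = t"
  shows "groebner_basis X (weight_order X \<omega>) (toric_ideal U X \<phi>) G"
    and "\<And>s t. (s, t) \<in> P \<Longrightarrow>
      initial_mono (weight_order X \<omega>) (binomial_poly (s, t) :: ('x, 'k) mpoly) = s"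
proof -
  let ?r = "weight_order X \<omega>" and ?I = "toric_ideal U X \<phi> :: ('x, 'k) mpoly set"
  let ?R = "poly_ring X :: ('x, 'k) mpoly ring"
  let ?inG = "{mono_poly (initial_mono ?r g) :: ('x, 'k) mpoly | g. g \<in> G}"
  let ?inI = "{mono_poly (initial_mono ?r f) :: ('x, 'k) mpoly | f. f \<in> ?I \<and> f \<noteq> 0}"
  note order = monomial_order_weight_order[of X \<omega>]
  interpret R: cring ?R
    by (rule cring_poly_ring)
  show initial: "initial_mono ?r (binomial_poly (s, t) :: ('x, 'k) mpoly) = s" if "(s, t) \<in> P" for s t
  proof -
    have "s \<noteq> t"
      using P[OF that] by auto
    then show ?thesis
      using P[OF that] by (intro initial_mono_eqI[OF order]) (auto simp: keys_binomial weight_order_def)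
  qed
  have G: "G \<subseteq> ?I" "0 \<notin> G"
  proof -
    have "binomial_poly (s, t) \<in> ?I \<and> binomial_poly (s, t) \<noteq> (0 :: ('x, 'k) mpoly)"
      if "(s, t) \<in> P" for s t
    proof -
      have "s \<noteq> t"
        using P[OF that] by auto
      note keys = keys_binomial[OF this, where 'k = 'k]
      moreover have "push_poly \<phi> (binomial_poly (s, t) :: ('x, 'k) mpoly) = 0"
        using P[OF that] by (simp add: binomial_poly_def push_poly_binomial_eq_0_iff)
      moreover have "binomial_poly (s, t) \<noteq> (0 :: ('x, 'k) mpoly)"
        using keys by (metis insert_not_empty keys_zero)
      ultimately show ?thesis
        using P[OF that] by (simp add: mem_toric_ideal_iff)
    qed
    then show "G \<subseteq> ?I" "0 \<notin> G"
      unfolding G_def by (metis image_subsetI surj_pair, metis imageE surj_pair)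
  qed
  have inG_carrier: "?inG \<subseteq> carrier ?R"
    using P initial by (auto simp: G_def carrier_poly_ring keys_mono_poly)
  have inI_carrier: "?inI \<subseteq> carrier ?R"
    by (auto simp: carrier_poly_ring keys_mono_poly mem_toric_ideal_iff
        intro: subsetD[OF _ initial_mono_max(1)[OF order]])
  have "?inI \<subseteq> Idl\<^bsub>?R\<^esub> ?inG"
  proof
    fix h assume "h \<in> ?inI"
    then obtain f where h: "h = mono_poly (initial_mono ?r f)" and f: "f \<in> ?I" "f \<noteq> 0"
      by blast
    let ?t = "initial_mono ?r f"
    have keys: "Poly_Mapping.keys f \<subseteq> monomials X" and push: "push_poly \<phi> f = 0"
      using f by (auto simp: mem_toric_ideal_iff)
    note max = initial_mono_max[OF order keys f(2)]
    have "\<not> irreducible_mono P ?t"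
    proof
      assume irr: "irreducible_mono P ?t"
      obtain u where u: "u \<in> Poly_Mapping.keys f" "u \<noteq> ?t" "mono_eval \<phi> u = mono_eval \<phi> ?t"
        by (rule push_poly_eq_0D[OF push max(1)])
      then have "u \<in> monomials X" and le: "(u, ?t) \<in> ?r"
        using keys max(2) by auto
      \<comment> \<open>\<open>u\<close> itself may be reducible, hence the passage to
        \<open>u'\<close>. Uniqueness makes \<open>u'\<close> equal to \<open>?t\<close>; but
        \<open>u'\<close> is either \<open>u\<close>, which differs from \<open>?t\<close>, or
        lighter than \<open>u\<close> and so lighter than \<open>?t\<close>.\<close>
      obtain u' where u': "u' \<in> monomials X" "irreducible_mono P u'"
          "mono_eval \<phi> u' = mono_eval \<phi> u" "u' = u \<or> mono_eval \<omega> u' < mono_eval \<omega> u"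
        using ex_irreducible_mono[of P X \<phi> \<omega> u, OF _ \<open>u \<in> monomials X\<close>] P by auto
      have "u' = ?t"
        by (rule unique) (use u' irr u(3) max(1) keys in auto)
      then show False
        using u'(4) u(2) le by (auto simp: weight_order_def)
    qed
    then obtain s t w where st: "(s, t) \<in> P" and t: "?t = s + w"
      by (auto simp: irreducible_mono_def)
    have "w \<in> monomials X"
      using max(1) keys t by (metis monomials_add_iff subsetD)
    moreover have "mono_poly s \<in> ?inG"
      using st initial[OF st] by (force simp: G_def)
    then have "mono_poly s \<in> Idl\<^bsub>?R\<^esub> ?inG"
      using R.genideal_self[OF inG_carrier] by blast
    ultimately have "mono_poly w \<otimes>\<^bsub>?R\<^esub> mono_poly s \<in> Idl\<^bsub>?R\<^esub> ?inG"
      using R.genideal_ideal[OF inG_carrier]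
      by (intro ideal.I_l_closed) (auto simp: carrier_poly_ring keys_mono_poly)
    then show "h \<in> Idl\<^bsub>?R\<^esub> ?inG"
      by (simp add: h t mono_poly_add poly_ring_def mult.commute)
  qed
  then have "Idl\<^bsub>?R\<^esub> ?inI \<subseteq> Idl\<^bsub>?R\<^esub> ?inG"
    by (intro R.genideal_minimal R.genideal_ideal inG_carrier)
  moreover have "Idl\<^bsub>?R\<^esub> ?inG \<subseteq> Idl\<^bsub>?R\<^esub> ?inI"
    using G by (intro R.subset_Idl_subset inI_carrier) auto
  ultimately have "Idl\<^bsub>?R\<^esub> ?inG = Idl\<^bsub>?R\<^esub> ?inI"
    by blast
  then show "groebner_basis X ?r ?I G"
    using G \<open>finite P\<close> by (simp add: groebner_basis_def initial_ideal_def G_def)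
qed

subsection \<open>Balanced pairs of labels\<close>

lemma sum_mset_le_mult_size: "(\<And>x. x \<in># M \<Longrightarrow> x \<le> c) \<Longrightarrow> \<Sum>\<^sub># M \<le> c * size M" for c :: nat
  by (induction M) (auto simp: add_mono)

lemma mult_size_le_sum_mset: "(\<And>x. x \<in># M \<Longrightarrow> c \<le> x) \<Longrightarrow> c * size M \<le> \<Sum>\<^sub># M" for c :: nat
  by (induction M) (auto simp: add_mono)

text \<open>Cancel the common part. What \<open>A\<close> has beyond \<open>P\<close> comes from
  \<open>Q\<close>, hence is at least the maximum \<open>c\<close> of \<open>P - A\<close>; it
  cannot equal \<open>c\<close>, which occurs less often in \<open>A\<close> than in
  \<open>P\<close>.\<close>

lemma sum_mset_less_lower_part:
  fixes A P Q :: "nat multiset"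
  assumes sep: "\<And>x y. x \<in># P \<Longrightarrow> y \<in># Q \<Longrightarrow> x \<le> y"
    and A: "A \<subseteq># P + Q" "size A = size P" "A \<noteq> P"
  shows "\<Sum>\<^sub># P < \<Sum>\<^sub># A"
proof -
  define c where "c = Max (set_mset (P - A))"
  have A_eq: "A = (A \<inter># P) + (A - P)" and P_eq: "P = (A \<inter># P) + (P - A)"
    by (auto simp: multiset_eq_iff)
  then have size_eq: "size (A - P) = size (P - A)"
    using A(2) by (metis add_left_imp_eq size_union)
  then have ne: "P - A \<noteq> {#}"
    using A(3) A_eq P_eq by (metis add.right_neutral size_eq_0_iff_empty)
  then have c: "c \<in># P - A"
    unfolding c_def by (intro Max_in) auto
  have "A - P \<subseteq># Q"
    using A(1) by (simp add: subset_eq_diff_conv add.commute)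
  have lower: "c + 1 \<le> y" if y: "y \<in># A - P" for y
  proof -
    have "c \<le> y"
      using sep c y \<open>A - P \<subseteq># Q\<close> by (meson in_diffD mset_subset_eqD)
    moreover have "c \<noteq> y"
      using c y by (auto simp: in_diff_count)
    ultimately show ?thesis
      by simp
  qed
  have "\<Sum>\<^sub># (P - A) \<le> c * size (P - A)"
    by (rule sum_mset_le_mult_size) (auto simp: c_def)
  also have "\<dots> < (c + 1) * size (A - P)"
    using ne by (simp add: size_eq nonempty_has_size)
  also have "\<dots> \<le> \<Sum>\<^sub># (A - P)"
    by (rule mult_size_le_sum_mset) (use lower in auto)
  finally show ?thesis
    using A_eq P_eq by (metis add_strict_left_mono sum_mset.union)
qed

text \<open>The total is fixed, so the claim follows from the lower part by passing to the
  complement of \<open>A\<close>.\<close>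

lemma sum_mset_less_upper_part:
  fixes A P Q :: "nat multiset"
  assumes sep: "\<And>x y. x \<in># P \<Longrightarrow> y \<in># Q \<Longrightarrow> x \<le> y"
    and A: "A \<subseteq># P + Q" "size A = size Q" "A \<noteq> Q"
  shows "\<Sum>\<^sub># A < \<Sum>\<^sub># Q"
proof -
  obtain B where B: "P + Q = A + B"
    using A(1) by (metis subset_mset.le_iff_add)
  have "size B = size P"
    using A(2) B by (metis add.commute add_right_imp_eq size_union)
  moreover have "B \<noteq> P"
    using A(3) B by (metis add.commute add_right_imp_eq)
  ultimately have "\<Sum>\<^sub># P < \<Sum>\<^sub># B"
    using B by (intro sum_mset_less_lower_part[OF sep]) auto
  moreover have "\<Sum>\<^sub># P + \<Sum>\<^sub># Q = \<Sum>\<^sub># A + \<Sum>\<^sub># B"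
    using B by (metis sum_mset.union)
  ultimately show ?thesis
    by linarith
qed

text \<open>Two different lower parts of the same multiset would each have a smaller sum than the
  other.\<close>

lemma lower_part_unique:
  fixes P Q P' Q' :: "nat multiset"
  assumes "\<And>x y. x \<in># P \<Longrightarrow> y \<in># Q \<Longrightarrow> x \<le> y" "\<And>x y. x \<in># P' \<Longrightarrow> y \<in># Q' \<Longrightarrow> x \<le> y"
    and "P + Q = P' + Q'" "size P = size P'"
  shows "P = P'"
proof (rule ccontr)
  assume "P \<noteq> P'"
  moreover have "P \<subseteq># P' + Q'" "P' \<subseteq># P + Q"
    using assms(3) by (metis mset_subset_eq_add_left, simp)
  ultimately have "\<Sum>\<^sub># P < \<Sum>\<^sub># P'"
    using assms(4) by (intro sum_mset_less_lower_part[OF assms(1)]) auto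
  moreover have "\<Sum>\<^sub># P' < \<Sum>\<^sub># P"
    using assms(4) \<open>P \<noteq> P'\<close> \<open>P \<subseteq># P' + Q'\<close> by (intro sum_mset_less_lower_part[OF assms(2)]) auto
  ultimately show False
    by simp
qed

section \<open>Balanced labels and their weights\<close>

definition nonones :: "nat multiset \<Rightarrow> nat multiset" where
  "nonones M = filter_mset (\<lambda>x. x \<noteq> 1) M"

lemma nonones_add [simp]: "nonones (M + N) = nonones M + nonones N"
  by (simp add: nonones_def)

lemma in_nonones_iff: "x \<in># nonones M \<longleftrightarrow> x \<in># M \<and> x \<noteq> 1"
  by (auto simp: nonones_def)

lemma ones_nonones: "M = replicate_mset (count M 1) 1 + nonones M"
  by (auto simp: multiset_eq_iff nonones_def)

lemma size_nonones: "size M = count M 1 + size (nonones M)"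
  by (subst ones_nonones) simp

lemma sum_nonones: "\<Sum>\<^sub># M = count M 1 + \<Sum>\<^sub># (nonones M)"
  by (subst ones_nonones) simp

text \<open>The relation is directed: \<open>M\<close> is the first label, which takes the surplus
  one when the number of ones is odd.\<close>

definition balanced :: "nat multiset \<Rightarrow> nat multiset \<Rightarrow> bool" where
  "balanced M N \<longleftrightarrow> count N 1 \<le> count M 1 \<and> count M 1 \<le> count N 1 + 1 \<and>
     (\<forall>x\<in>#nonones M. \<forall>y\<in>#nonones N. x \<le> y)"

text \<open>Strict convexity of squaring: the total is the same, and \<open>a\<close> and
  \<open>b\<close> lie strictly between \<open>c\<close> and \<open>d\<close>.\<close>

lemma sum_squares_less:
  fixes a b c d :: nat
  assumes "a + b = c + d" "c < a" "a < d"
  shows "a\<^sup>2 + b\<^sup>2 < c\<^sup>2 + d\<^sup>2"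
proof -
  obtain k where k: "a = c + k" "k > 0"
    using assms(2) less_imp_add_positive by blast
  then have d: "d = b + k" and "c < b"
    using assms by auto
  then have "c * k < b * k"
    using k(2) by simp
  moreover have "(c + k)\<^sup>2 + b\<^sup>2 + 2 * (b * k) = c\<^sup>2 + (b + k)\<^sup>2 + 2 * (c * k)"
    by (simp add: power2_eq_square algebra_simps)
  ultimately show ?thesis
    unfolding k(1) d by linarith
qed

text \<open>Balancing the number of ones minimises the sum of its squares; after that, splitting the
  other letters at one place makes the two letter sums as far apart as possible, and so maximises
  the sum of their squares. A surplus one in the first label does not disturb this, since all other
  letters exceed 1.\<close>

lemma balanced_weights_ordered:
  assumes MN: "M + N = S + T" and size: "size M = n" "size N = n" "size S = n" "size T = n"
    and pos: "0 \<notin># T" and ST: "balanced S T"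
    and ne: "M \<noteq> S" "\<not> (M = T \<and> N = S)" and le: "count N 1 \<le> count M 1"
  shows "(count S 1)\<^sup>2 + (count T 1)\<^sup>2 < (count M 1)\<^sup>2 + (count N 1)\<^sup>2 \<or>
    (count S 1)\<^sup>2 + (count T 1)\<^sup>2 = (count M 1)\<^sup>2 + (count N 1)\<^sup>2 \<and>
    (\<Sum>\<^sub># M)\<^sup>2 + (\<Sum>\<^sub># N)\<^sup>2 < (\<Sum>\<^sub># S)\<^sup>2 + (\<Sum>\<^sub># T)\<^sup>2"
proof -
  have cnt: "count M 1 + count N 1 = count S 1 + count T 1"
    using MN by (metis count_union)
  have sums: "\<Sum>\<^sub># M + \<Sum>\<^sub># N = \<Sum>\<^sub># S + \<Sum>\<^sub># T"
    using MN by (metis sum_mset.union)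
  have non: "nonones M + nonones N = nonones S + nonones T"
    using MN by (metis nonones_add)
  have bal: "count T 1 \<le> count S 1" "count S 1 \<le> count T 1 + 1"
    and sep: "\<And>x y. x \<in># nonones S \<Longrightarrow> y \<in># nonones T \<Longrightarrow> x \<le> y"
    using ST by (auto simp: balanced_def)
  show ?thesis
  proof (cases "count M 1 = count S 1")
    case True
    have sub: "nonones M \<subseteq># nonones S + nonones T"
      using non by (metis mset_subset_eq_add_left)
    have "nonones M \<noteq> nonones S"
      using ne(1) True by (metis ones_nonones)
    moreover have "size (nonones M) = size (nonones S)"
      using True size size_nonones[of M] size_nonones[of S] by simp
    ultimately have "\<Sum>\<^sub># (nonones S) < \<Sum>\<^sub># (nonones M)"
      by (intro sum_mset_less_lower_part[OF sep sub])
    then have less: "\<Sum>\<^sub># S < \<Sum>\<^sub># M"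
      using True sum_nonones[of M] sum_nonones[of S] by simp
    have "\<Sum>\<^sub># M < \<Sum>\<^sub># T"
    proof (cases "count S 1 = count T 1")
      case eq: True
      have "M \<noteq> T"
        using ne(2) MN by (metis add.commute add_right_imp_eq)
      then have "nonones M \<noteq> nonones T"
        using True eq by (metis ones_nonones)
      moreover have "size (nonones M) = size (nonones T)"
        using True eq size size_nonones[of M] size_nonones[of T] by simp
      ultimately have "\<Sum>\<^sub># (nonones M) < \<Sum>\<^sub># (nonones T)"
        by (intro sum_mset_less_upper_part[OF sep sub])
      then show ?thesis
        using True eq sum_nonones[of M] sum_nonones[of T] by simp
    next
      case False
      then have suc: "count S 1 = count T 1 + 1"
        using bal by simp
      then have size_T: "size (nonones T) = size (nonones M) + 1"
        using True size size_nonones[of M] size_nonones[of T] by simp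
      \<comment> \<open>\<open>T\<close> has one more letter different from 1 than \<open>M\<close>.
        Assigning its smallest such letter \<open>y\<close> to the lower side makes the sizes agree;
        as \<open>y\<close> is at least 2, it outweighs the surplus one of \<open>M\<close>.\<close>
      define y where "y = Min (set_mset (nonones T))"
      have y: "y \<in># nonones T"
        unfolding y_def using size_T by (intro Min_in) auto
      then obtain U where U: "nonones T = add_mset y U"
        by (metis insert_DiffM)
      have y_min: "y \<le> z" if "z \<in># nonones T" for z
        unfolding y_def using that by simp
      have "y \<noteq> 0" "y \<noteq> 1"
        using y pos by (metis in_nonones_iff)+
      have "\<Sum>\<^sub># (nonones M) \<le> \<Sum>\<^sub># U"
      proof (cases "nonones M = U")
        case False
        then have "\<Sum>\<^sub># (nonones M) < \<Sum>\<^sub># U"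
        proof (intro sum_mset_less_upper_part[of "add_mset y (nonones S)" U])
          show "nonones M \<subseteq># add_mset y (nonones S) + U"
            using sub U by simp
          show "x \<le> z" if "x \<in># add_mset y (nonones S)" "z \<in># U" for x z
            using that sep[of x z] y_min[of z] by (auto simp: U)
        qed (use size_T in \<open>simp_all add: U\<close>)
        then show ?thesis
          by simp
      qed simp
      then show ?thesis
        using True suc sum_nonones[of M] sum_nonones[of T] \<open>y \<noteq> 0\<close> \<open>y \<noteq> 1\<close> by (simp add: U)
    qed
    then show ?thesis
      using sum_squares_less[OF sums less] True cnt by (intro disjI2 conjI) simp_all
  next
    case False
    \<comment> \<open>\<open>S\<close> and \<open>T\<close> share the ones as evenly as possible, so
      any other distribution has more ones than \<open>S\<close> in its larger half and fewer than
      \<open>T\<close> in its smaller half.\<close>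
    then have "count S 1 + count T 1 = count N 1 + count M 1" "count N 1 < count S 1"
        "count S 1 < count M 1"
      using cnt le bal by linarith+
    then show ?thesis
      using sum_squares_less[of "count S 1" "count T 1" "count N 1" "count M 1"] by simp
  qed
qed

lemma balanced_weights:
  assumes MN: "M + N = S + T" and size: "size M = n" "size N = n" "size S = n" "size T = n"
    and pos: "0 \<notin># T" and ST: "balanced S T"
    and ne: "\<not> (M = S \<and> N = T)" "\<not> (M = T \<and> N = S)"
  shows "(count S 1)\<^sup>2 + (count T 1)\<^sup>2 < (count M 1)\<^sup>2 + (count N 1)\<^sup>2 \<or>
    (count S 1)\<^sup>2 + (count T 1)\<^sup>2 = (count M 1)\<^sup>2 + (count N 1)\<^sup>2 \<and>
    (\<Sum>\<^sub># M)\<^sup>2 + (\<Sum>\<^sub># N)\<^sup>2 < (\<Sum>\<^sub># S)\<^sup>2 + (\<Sum>\<^sub># T)\<^sup>2"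
proof (cases "count N 1 \<le> count M 1")
  case True
  have "M \<noteq> S"
    using ne(1) MN by auto
  then show ?thesis
    using balanced_weights_ordered[OF MN size pos ST] ne True by blast
next
  case False
  have "N \<noteq> S"
    using ne(2) MN by (metis add.commute add_left_imp_eq)
  then show ?thesis
    using balanced_weights_ordered[of N M S T n] assms False by (auto simp: add.commute)
qed

subsection \<open>Pairwise balanced monomials\<close>

text \<open>Quantifying over factorizations instead of pairs of variables compares a variable with
  itself exactly when it occurs at least twice.\<close>

definition pairwise_balanced :: "('x \<Rightarrow> nat multiset) \<Rightarrow> 'x mono \<Rightarrow> bool" where
  "pairwise_balanced L t \<longleftrightarrow>
    (\<forall>v w u. t = mono_var v + (mono_var w + u) \<longrightarrow> balanced (L v) (L w) \<or> balanced (L w) (L v))"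

lemma pairwise_balanced_summand:
  assumes "pairwise_balanced L (s + t)"
  shows "pairwise_balanced L t"
  unfolding pairwise_balanced_def
proof (intro allI impI)
  fix v w u assume "t = mono_var v + (mono_var w + u)"
  then have "s + t = mono_var v + (mono_var w + (s + u))"
    by (simp add: ac_simps)
  then show "balanced (L v) (L w) \<or> balanced (L w) (L v)"
    using assms by (auto simp: pairwise_balanced_def)
qed

text \<open>Take a label with the most ones and, among these, the least letter sum. If some
  \<open>w\<close> were balanced only in the reverse direction, it would have as many ones and,
  being the lower part, a smaller sum.\<close>

lemma pairwise_balanced_first:
  assumes "pairwise_balanced L t" "t \<noteq> 0"
    and size: "\<And>v. v \<in> Poly_Mapping.keys t \<Longrightarrow> size (L v) = n"
  obtains v t' where "t = mono_var v + t'"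
    "\<And>w. w \<in> Poly_Mapping.keys t' \<Longrightarrow> balanced (L v) (L w)"
proof -
  let ?K = "Poly_Mapping.keys t"
  have "?K \<noteq> {}"
    using assms(2) by (metis all_not_in_conv in_keys_iff lookup_zero poly_mapping_eqI)
  \<comment> \<open>Minimizing the difference to \<open>n\<close> maximizes the number of ones;
    nothing is truncated, because labels have \<open>n\<close> letters.\<close>
  then obtain v0 where v0: "v0 \<in> ?K" "\<And>w. w \<in> ?K \<Longrightarrow> n - count (L v0) 1 \<le> n - count (L w) 1"
    using ex_has_least_nat[of "\<lambda>v. v \<in> ?K" _ "\<lambda>v. n - count (L v) 1"] by blast
  then obtain v where v: "v \<in> ?K" "count (L v) 1 = count (L v0) 1"
    "\<And>w. w \<in> ?K \<Longrightarrow> count (L w) 1 = count (L v0) 1 \<Longrightarrow> \<Sum>\<^sub># (L v) \<le> \<Sum>\<^sub># (L w)"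
    using ex_has_least_nat[of "\<lambda>v. v \<in> ?K \<and> count (L v) 1 = count (L v0) 1" v0 "\<lambda>v. \<Sum>\<^sub># (L v)"]
    by blast
  have ones_le: "count (L w) 1 \<le> n" if "w \<in> ?K" for w
    using size[OF that] count_le_size by metis
  have max: "count (L w) 1 \<le> count (L v) 1" if "w \<in> ?K" for w
    using v0(2)[OF that] ones_le[OF v0(1)] ones_le[OF that] v(2) by linarith
  obtain t' where t: "t = mono_var v + t'"
    using mono_split[OF v(1)] .
  have "balanced (L v) (L w)" if w: "w \<in> Poly_Mapping.keys t'" for w
  proof (rule ccontr)
    assume not: "\<not> balanced (L v) (L w)"
    obtain u where "t' = mono_var w + u"
      using mono_split[OF w] .
    then have bal: "balanced (L w) (L v)"
      using assms(1) not by (auto simp: t pairwise_balanced_def)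
    have wK: "w \<in> ?K"
      using w by (simp add: t keys_add_nat)
    have ones: "count (L w) 1 = count (L v) 1"
      using max[OF wK] bal by (simp add: balanced_def)
    have "nonones (L v) \<noteq> nonones (L w)"
      using ones bal not by (metis ones_nonones)
    moreover have "size (nonones (L v)) = size (nonones (L w))"
      using ones size[OF wK] size[OF v(1)] size_nonones[of "L v"] size_nonones[of "L w"] by simp
    ultimately have "\<Sum>\<^sub># (nonones (L w)) < \<Sum>\<^sub># (nonones (L v))"
      using bal by (intro sum_mset_less_lower_part[of "nonones (L w)" "nonones (L v)"])
        (auto simp: balanced_def)
    then show False
      using v(3)[OF wK] ones v(2) sum_nonones[of "L v"] sum_nonones[of "L w"] by simp
  qed
  then show thesis
    using that t by blast
qed

section \<open>Recovering a pairwise balanced monomial from its letters\<close>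

lemma in_mono_eval_iff: "x \<in># mono_eval L t \<longleftrightarrow> (\<exists>v\<in>Poly_Mapping.keys t. x \<in># L v)"
  by (induction t rule: mono_induct) (auto simp: mono_eval_add keys_add_nat)

lemma size_mono_eval:
  fixes L :: "'x \<Rightarrow> 'a multiset"
  assumes "\<And>v. v \<in> Poly_Mapping.keys t \<Longrightarrow> size (L v) = n"
  shows "size (mono_eval L t) = n * mono_degree t"
  using assms
proof (induction t rule: mono_induct)
  case (add v t)
  then have "size (L v) = n" "size (mono_eval L t) = n * mono_degree t"
    by (auto simp: keys_add_nat)
  then show ?case
    by (simp add: mono_eval_add mono_degree_eq_mono_eval)
qed (simp add: mono_degree_eq_mono_eval)

lemma count_mono_eval_bounds:
  assumes "\<And>v. v \<in> Poly_Mapping.keys t \<Longrightarrow> count (L v) x \<le> a \<and> a \<le> count (L v) x + 1"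
  shows "count (mono_eval L t) x \<le> a * mono_degree t \<and>
    a * mono_degree t \<le> count (mono_eval L t) x + mono_degree t"
  using assms
proof (induction t rule: mono_induct)
  case (add v t)
  then have "count (L v) x \<le> a \<and> a \<le> count (L v) x + 1"
    "count (mono_eval L t) x \<le> a * mono_degree t \<and>
      a * mono_degree t \<le> count (mono_eval L t) x + mono_degree t"
    by (auto simp: keys_add_nat)
  then show ?case
    by (simp add: mono_eval_add mono_degree_eq_mono_eval)
qed (simp add: mono_degree_eq_mono_eval)

text \<open>Both \<open>a\<close> and \<open>b\<close> are the quotient of \<open>N\<close> by
  \<open>d + 1\<close>, rounded up: the share of the first label when \<open>N\<close> ones are
  spread evenly over \<open>d + 1\<close> labels.\<close>

lemma first_ones_unique:
  fixes a b d N :: nat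
  assumes "N \<le> a * (d + 1)" "a * (d + 1) \<le> N + d" "N \<le> b * (d + 1)" "b * (d + 1) \<le> N + d"
  shows "a = b"
proof -
  have "\<not> x < y" if "N \<le> x * (d + 1)" "y * (d + 1) \<le> N + d" for x y
  proof
    assume "x < y"
    then have "(x + 1) * (d + 1) \<le> y * (d + 1)"
      by (intro mult_right_mono) auto
    then show False
      using that by (simp add: algebra_simps)
  qed
  then show ?thesis
    using assms by (metis linorder_neqE_nat)
qed

text \<open>Every other label has as many ones as the first or one fewer, so the first number is the
  rounded average. The remaining letters of the first label are the lower part of all letters
  different from 1.\<close>

lemma first_label_unique:
  assumes eq: "mono_eval L (mono_var v + s) = mono_eval L (mono_var w + t)"
    and deg: "mono_degree s = mono_degree t" and size: "size (L v) = size (L w)"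
    and v: "\<And>x. x \<in> Poly_Mapping.keys s \<Longrightarrow> balanced (L v) (L x)"
    and w: "\<And>x. x \<in> Poly_Mapping.keys t \<Longrightarrow> balanced (L w) (L x)"
  shows "L v = L w"
proof -
  let ?N = "count (mono_eval L (mono_var v + s)) 1"
  have "count (L v) 1 = count (L w) 1"
  proof (rule first_ones_unique[where N = ?N and d = "mono_degree s"])
    have "count (mono_eval L s) 1 \<le> count (L v) 1 * mono_degree s \<and>
      count (L v) 1 * mono_degree s \<le> count (mono_eval L s) 1 + mono_degree s"
      using v by (intro count_mono_eval_bounds) (auto simp: balanced_def)
    then show "?N \<le> count (L v) 1 * (mono_degree s + 1)"
        "count (L v) 1 * (mono_degree s + 1) \<le> ?N + mono_degree s"
      by (auto simp: mono_eval_add)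
    have "?N = count (L w) 1 + count (mono_eval L t) 1"
      by (simp add: eq, simp add: mono_eval_add)
    have "count (mono_eval L t) 1 \<le> count (L w) 1 * mono_degree t \<and>
      count (L w) 1 * mono_degree t \<le> count (mono_eval L t) 1 + mono_degree t"
      using w by (intro count_mono_eval_bounds) (auto simp: balanced_def)
    then show "?N \<le> count (L w) 1 * (mono_degree s + 1)"
        "count (L w) 1 * (mono_degree s + 1) \<le> ?N + mono_degree s"
      using \<open>?N = count (L w) 1 + count (mono_eval L t) 1\<close> by (auto simp: deg)
  qed
  moreover have "nonones (L v) = nonones (L w)"
  proof (rule lower_part_unique)
    show "nonones (L v) + nonones (mono_eval L s) = nonones (L w) + nonones (mono_eval L t)"
      using eq by (metis mono_eval_add mono_eval_mono_var nonones_add)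
    show "size (nonones (L v)) = size (nonones (L w))"
      using size calculation size_nonones[of "L v"] size_nonones[of "L w"] by simp
    show "x \<le> y" if "x \<in># nonones (L v)" "y \<in># nonones (mono_eval L s)" for x y
      using that v by (auto simp: in_nonones_iff in_mono_eval_iff balanced_def)
    show "x \<le> y" if "x \<in># nonones (L w)" "y \<in># nonones (mono_eval L t)" for x y
      using that w by (auto simp: in_nonones_iff in_mono_eval_iff balanced_def)
  qed
  ultimately show ?thesis
    by (metis ones_nonones)
qed

lemma mono_degree_eq_0_iff: "mono_degree t = 0 \<longleftrightarrow> t = 0"
proof
  assume deg: "mono_degree t = 0"
  show "t = 0"
  proof (rule poly_mapping_eqI)
    fix v
    show "Poly_Mapping.lookup t v = Poly_Mapping.lookup 0 v"
      using deg by (cases "v \<in> Poly_Mapping.keys t") (auto simp: mono_degree_def in_keys_iff)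
  qed
qed (simp add: mono_degree_def)

text \<open>The number of letters determines the degree, and the letters determine the first label.
  Cancelling its variable leaves two monomials of smaller degree.\<close>

lemma pairwise_balanced_unique:
  assumes "inj_on L X" "\<And>v. v \<in> X \<Longrightarrow> size (L v) = n" "n > 0"
    and "s \<in> monomials X" "t \<in> monomials X"
    and "pairwise_balanced L s" "pairwise_balanced L t" "mono_eval L s = mono_eval L t"
  shows "s = t"
  using assms(4-)
proof (induction "mono_degree s" arbitrary: s t rule: less_induct)
  case (less s t)
  have size: "size (L v) = n" if "v \<in> Poly_Mapping.keys s \<or> v \<in> Poly_Mapping.keys t" for v
    using that less.prems assms(2) by (auto simp: monomials_def)
  have "size (mono_eval L s) = n * mono_degree s" "size (mono_eval L t) = n * mono_degree t"
    by (rule size_mono_eval, use size in simp)+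
  then have deg: "mono_degree s = mono_degree t"
    using \<open>n > 0\<close> less.prems(5) by simp
  show ?case
  proof (cases "s = 0")
    case True
    then show ?thesis
      using deg by (metis mono_degree_eq_0_iff)
  next
    case False
    then have "t \<noteq> 0"
      using deg by (metis mono_degree_eq_0_iff)
    obtain v s' where s: "s = mono_var v + s'"
        "\<And>x. x \<in> Poly_Mapping.keys s' \<Longrightarrow> balanced (L v) (L x)"
      by (rule pairwise_balanced_first[OF less.prems(3) False, of n]) (use size in auto)
    obtain w t' where t: "t = mono_var w + t'"
        "\<And>x. x \<in> Poly_Mapping.keys t' \<Longrightarrow> balanced (L w) (L x)"
      by (rule pairwise_balanced_first[OF less.prems(4) \<open>t \<noteq> 0\<close>, of n]) (use size in auto)
    have deg': "mono_degree s' = mono_degree t'" "mono_degree s' < mono_degree s"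
      using deg by (auto simp: s(1) t(1) mono_degree_eq_mono_eval mono_eval_add)
    have "L v = L w"
      using less.prems(5) size deg'(1) s t
      by (intro first_label_unique[of L v s' w t']) (auto simp: keys_add_nat)
    then have "v = w"
      using assms(1) less.prems(1,2)
      by (auto simp: s(1) t(1) monomials_add_iff mono_var_in_monomials dest: inj_onD)
    moreover have "s' = t'"
    proof (rule less.hyps[OF deg'(2)])
      show "mono_eval L s' = mono_eval L t'"
        using less.prems(5) \<open>v = w\<close> by (simp add: s(1) t(1) mono_eval_add)
    qed (use less.prems s(1) t(1) in
        \<open>auto simp: monomials_add_iff intro: pairwise_balanced_summand\<close>)
    ultimately show ?thesis
      by (simp add: s t)
  qed
qed

text \<open>The pairwise condition alone would allow labels containing 1, 2 and 3 separately; the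
  balancing rules this out, because the label with the ones also gets the smallest other letters.\<close>

lemma pairwise_balanced_avoids_123:
  assumes "pairwise_balanced L t" "n > 1"
    and size: "\<And>v. v \<in> Poly_Mapping.keys t \<Longrightarrow> size (L v) = n"
    and pos: "\<And>v. v \<in> Poly_Mapping.keys t \<Longrightarrow> 0 \<notin># L v"
    and single: "\<And>v. v \<in> Poly_Mapping.keys t \<Longrightarrow> \<not> {1, 2, 3} \<subseteq> set_mset (L v)"
    and pair: "\<And>v w u. t = mono_var v + (mono_var w + u) \<Longrightarrow> \<not> {1, 2, 3} \<subseteq> set_mset (L v + L w)"
  shows "\<not> {1, 2, 3} \<subseteq> set_mset (mono_eval L t)"
proof
  assume sub: "{1, 2, 3} \<subseteq> set_mset (mono_eval L t)"
  then have "t \<noteq> 0"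
    by auto
  then obtain v t' where t: "t = mono_var v + t'"
      and first: "\<And>w. w \<in> Poly_Mapping.keys t' \<Longrightarrow> balanced (L v) (L w)"
    using pairwise_balanced_first[OF assms(1) _ size] by metis
  have keys_t: "Poly_Mapping.keys t = insert v (Poly_Mapping.keys t')"
    by (simp add: t keys_add_nat)
  have avoid_v: "\<not> {1, 2, 3} \<subseteq> set_mset (L v + L w)" if "w \<in> Poly_Mapping.keys t'" for w
    using mono_split[OF that] pair t by metis
  obtain x y z where xyz: "{x, y, z} \<subseteq> Poly_Mapping.keys t" "1 \<in># L x" "2 \<in># L y" "3 \<in># L z"
    using sub by (auto simp: in_mono_eval_iff)
  have one: "1 \<in># L v"
  proof (cases "x = v")
    case False
    then have "count (L x) 1 \<le> count (L v) 1"
      using first xyz keys_t by (auto simp: balanced_def)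
    moreover have "count (L x) 1 > 0"
      using xyz(2) by simp
    ultimately show ?thesis
      by (metis count_greater_zero_iff less_le_trans)
  qed (use xyz in simp)
  show False
  proof (cases "2 \<in># L v")
    case True
    then have "z \<noteq> v"
      using one xyz single[of v] keys_t by auto
    then show False
      using avoid_v[of z] one True xyz keys_t by auto
  next
    case False
    then have y: "y \<in> Poly_Mapping.keys t'"
      using xyz keys_t by auto
    \<comment> \<open>Letters of the first label other than 1 are at most the 2 in
      \<open>L y\<close>, and 2 is absent from it, so this label consists of ones.\<close>
    have "a = 1" if a: "a \<in># L v" for a
    proof (rule ccontr)
      assume "a \<noteq> 1"
      then have "a \<le> 2"
        using first[OF y] a xyz by (auto simp: balanced_def in_nonones_iff)
      moreover have "a \<noteq> 0" "a \<noteq> 2"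
        using a False pos[of v] keys_t by (metis insertI1, metis)
      ultimately show False
        using \<open>a \<noteq> 1\<close> by simp
    qed
    then have only: "set_mset (L v) \<subseteq> {1}"
      by auto
    then have "nonones (L v) = {#}"
      by (metis in_nonones_iff multiset_nonemptyE singletonD subsetD)
    then have "count (L v) 1 = n"
      using size[of v] size_nonones[of "L v"] keys_t by simp
    \<comment> \<open>Balance leaves at least \<open>n - 1\<close> ones, hence one or more, in every
      other label. The labels with 2 and 3 then form a forbidden pair by themselves.\<close>
    then have ones: "1 \<in># L w" if "w \<in> Poly_Mapping.keys t'" for w
      using first[OF that] \<open>n > 1\<close> by (intro count_inI) (simp add: balanced_def)
    have z: "z \<in> Poly_Mapping.keys t'"
      using xyz keys_t only by auto
    have "y \<noteq> z"
      using ones[OF z] xyz single[of z] by auto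
    obtain u where u: "t' = mono_var y + u"
      using mono_split[OF y] .
    then have "z \<in> Poly_Mapping.keys u"
      using z \<open>y \<noteq> z\<close> by (auto simp: keys_add_nat)
    then obtain u' where "u = mono_var z + u'"
      by (rule mono_split)
    then have "t = mono_var y + (mono_var z + (mono_var v + u'))"
      using t u by (simp add: ac_simps)
    then show False
      using pair[of y z] ones[OF y] xyz by auto
  qed
qed

declare One_nat_def [simp del]

subsection \<open>Sorting letters\<close>

lemma sorted_eq_replicate_ones:
  fixes xs :: "nat list"
  assumes "sorted xs" "0 \<notin> set xs"
  shows "xs = replicate (count (mset xs) 1) 1 @ filter (\<lambda>x. x \<noteq> 1) xs"
proof -
  have "1 \<le> x" if "x \<in> set xs" for x
    using that assms(2) by (metis less_one not_le)
  have "mset xs = mset (replicate (count (mset xs) 1) 1 @ filter (\<lambda>x. x \<noteq> 1) xs)"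
    by (auto simp: multiset_eq_iff)
  moreover have "sorted (replicate (count (mset xs) 1) 1 @ filter (\<lambda>x. x \<noteq> 1) xs)"
    using assms(1) \<open>\<And>x. x \<in> set xs \<Longrightarrow> 1 \<le> x\<close> by (auto simp: sorted_append sorted_wrt_filter)
  ultimately show ?thesis
    using assms(1) by (metis properties_for_sort sort_key_id_if_sorted)
qed

text \<open>Here \<alpha> is \<open>n\<close> minus half the number of ones, rounded down. An odd 1
  stays at the head of \<open>J\<close>, which is why the condition concerns \<open>J ! 1\<close>;
  fewer than \<open>2 * n\<close> ones keep \<alpha> positive.\<close>

lemma split_ones:
  fixes xs :: "nat list"
  assumes "sorted xs" "0 \<notin> set xs" "length xs = 2 * n" "count (mset xs) 1 < 2 * n"
  obtains \<alpha> J where "1 \<le> \<alpha>" "\<alpha> \<le> n" "length J = 2 * \<alpha>"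
    "xs = replicate (2 * (n - \<alpha>)) 1 @ J" "J ! 1 > 1"
proof -
  define N where "N = count (mset xs) 1"
  define k where "k = N div 2"
  have xs: "xs = replicate N 1 @ filter (\<lambda>x. x \<noteq> 1) xs"
    unfolding N_def by (rule sorted_eq_replicate_ones[OF assms(1,2)])
  have k: "2 * k \<le> N" "N \<le> 2 * k + 1" "k < n"
    using assms(4) by (auto simp: k_def N_def)
  show thesis
  proof (rule that[of "n - k" "drop (2 * k) xs"])
    have "take (2 * k) xs = replicate (2 * k) 1"
      using k by (subst xs) (simp add: min_absorb1)
    then show "xs = replicate (2 * (n - (n - k))) 1 @ drop (2 * k) xs"
      using k append_take_drop_id[of "2 * k" xs] by simp
    have "xs ! (2 * k + 1) = filter (\<lambda>x. x \<noteq> 1) xs ! (2 * k + 1 - N)"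
      using k by (subst xs) (simp add: nth_append)
    moreover have "2 * k + 1 - N < length (filter (\<lambda>x. x \<noteq> 1) xs)"
      using k assms(3) arg_cong[OF xs, of length] by simp
    ultimately have "xs ! (2 * k + 1) \<in> set (filter (\<lambda>x. x \<noteq> 1) xs)"
      by (metis nth_mem)
    then have "xs ! (2 * k + 1) \<noteq> 0" "xs ! (2 * k + 1) \<noteq> 1"
      using assms(2) by (auto intro: ccontr)
    then show "drop (2 * k) xs ! 1 > 1"
      using k assms(3) by simp
  qed (use k assms(3) in auto)
qed

text \<open>Only the head of \<open>J\<close> can be 1, and as \<alpha> is positive it falls into
  the first half.\<close>

lemma balanced_split:
  fixes J :: "nat list"
  assumes "sorted (replicate k 1 @ J)" "0 \<notin> set J" "length J = 2 * \<alpha>" "1 \<le> \<alpha>" "J ! 1 > 1"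
  shows "balanced (mset (replicate l 1 @ take \<alpha> J)) (mset (replicate l 1 @ drop \<alpha> J))"
proof -
  have sorted: "sorted J"
    using assms(1) by (simp add: sorted_append)
  obtain x K where J: "J = x # K"
    using assms(3,4) by (cases J) auto
  have K: "1 < y" if "y \<in> set K" for y
  proof -
    have "K \<noteq> []"
      using that by auto
    then have "K ! 0 \<le> y"
      using sorted that by (cases K) (auto simp: J)
    then show ?thesis
      using assms(5) by (simp add: J)
  qed
  have "count (mset (take \<alpha> J)) 1 \<le> 1"
  proof -
    obtain \<beta> where \<beta>: "\<alpha> = Suc \<beta>"
      using assms(4) by (cases \<alpha>) auto
    have "1 \<notin> set (take \<beta> K)"
      using K by (auto dest: in_set_takeD)
    then have "count (mset (take \<beta> K)) 1 = 0"
      by (simp add: count_eq_zero_iff)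
    moreover have "count (mset (take \<alpha> J)) 1 \<le> 1 + count (mset (take \<beta> K)) 1"
      by (simp add: J \<beta>)
    ultimately show ?thesis
      by linarith
  qed
  moreover have "1 \<notin> set (drop \<alpha> J)"
  proof -
    obtain \<beta> where \<beta>: "\<alpha> = Suc \<beta>"
      using assms(4) by (cases \<alpha>) auto
    show ?thesis
      using K by (auto simp: J \<beta> dest: in_set_dropD)
  qed
  then have "count (mset (drop \<alpha> J)) 1 = 0"
    by (simp add: count_eq_zero_iff)
  moreover have "x \<le> y" if "x \<in> set (take \<alpha> J)" "y \<in> set (drop \<alpha> J)" for x y
    using that sorted by (metis append_take_drop_id sorted_append)
  moreover have "count (mset (replicate l 1 @ take \<alpha> J)) 1 = l + count (mset (take \<alpha> J)) 1"
      "count (mset (replicate l 1 @ drop \<alpha> J)) 1 = l + count (mset (drop \<alpha> J)) 1"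
    by simp_all
  ultimately show ?thesis
    unfolding balanced_def by (intro conjI) (linarith, linarith, auto simp: in_nonones_iff split: if_splits)
qed

lemma mset_split_sort:
  assumes "sort (L1 @ L2) = replicate (2 * k) 1 @ J"
  shows "mset L1 + mset L2 = mset (replicate k 1 @ take a J) + mset (replicate k 1 @ drop a J)"
proof -
  have J: "mset J = mset (take a J) + mset (drop a J)"
    by (metis append_take_drop_id mset_append)
  have "mset L1 + mset L2 = mset (sort (L1 @ L2))"
    by simp
  also have "\<dots> = mset (replicate k 1 @ take a J) + mset (replicate k 1 @ drop a J)"
    unfolding assms by (simp add: J multiset_eq_iff)
  finally show ?thesis .
qed

lemma mset_triple_eq:
  assumes "{a, b, c} = {x, y, z}" "x \<noteq> y" "x \<noteq> z" "y \<noteq> z"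
  shows "{#a, b, c#} = {#x, y, z#}"
proof -
  have "card {a, b, c} = 3"
    using assms by simp
  then have "distinct [a, b, c]"
    by (intro card_distinct) simp
  moreover have "distinct [x, y, z]"
    using assms by simp
  ultimately have "mset [a, b, c] = mset [x, y, z]"
    using assms(1) by (subst set_eq_iff_mset_eq_distinct[symmetric]) auto
  then show ?thesis
    by simp
qed

text \<open>Comparison of two-digit numbers in base \<open>D\<close>; the lower digit on the larger
  side is unrestricted.\<close>

lemma lex_weight_less:
  fixes a b x y D :: nat
  assumes "a < b \<or> a = b \<and> x < y" "x < D"
  shows "D * a + x < D * b + y"
proof (cases "a < b")
  case True
  then have "D * (a + 1) \<le> D * b"
    by (intro mult_left_mono) auto
  then have "D * a + D \<le> D * b"
    by (simp only: distrib_left mult_1_right)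
  then show ?thesis
    using assms(2) by simp
qed (use assms in auto)

subsection \<open>Standard labels\<close>

definition low_letters :: "nat multiset \<Rightarrow> nat" where
  "low_letters M = size (filter_mset (\<lambda>x. x \<le> 3) M)"

lemma low_letters_add: "low_letters (M + N) = low_letters M + low_letters N"
  by (simp add: low_letters_def)

text \<open>\<open>standard_unique\<close> leaves the sizes of the multisets free, because it serves
  both for single labels and for the product of all labels of a monomial.\<close>

locale nested_labels =
  fixes n :: nat and m :: "nat \<Rightarrow> nat mono"
  assumes n_gt_1: "n > 1"
    and relation: "m 1 + m 2 + m 3 = m 4 + m 5 + m 6"
    and standard_unique: "\<And>M N. set_mset M \<subseteq> {1..6} \<Longrightarrow> set_mset N \<subseteq> {1..6} \<Longrightarrow>
      \<not> {1, 2, 3} \<subseteq> set_mset M \<Longrightarrow> \<not> {1, 2, 3} \<subseteq> set_mset N \<Longrightarrow>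
      \<Sum>\<^sub># (image_mset m M) = \<Sum>\<^sub># (image_mset m N) \<Longrightarrow> M = N"
begin

definition monomial :: "nat multiset \<Rightarrow> nat mono" where
  "monomial M = \<Sum>\<^sub># (image_mset m M)"

definition X :: "nat mono set" where
  "X = nested_configuration n (m ` {1..6})"

abbreviation "P \<equiv> binomials_i n m \<union> binomials_ii n m"

definition label :: "nat multiset \<Rightarrow> bool" where
  "label M \<longleftrightarrow> set_mset M \<subseteq> {1..6} \<and> size M = n"

definition standard :: "nat multiset \<Rightarrow> bool" where
  "standard M \<longleftrightarrow> label M \<and> \<not> {1, 2, 3} \<subseteq> set_mset M"

lemma monomial_add: "monomial (M + N) = monomial M + monomial N"
  by (simp add: monomial_def)

lemma label_var_eq: "label_var m js = monomial (mset js)"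
  by (simp add: label_var_def monomial_def flip: sum_mset_sum_list)

lemma X_eq: "X = monomial ` {M. label M}"
proof -
  have "X = label_var m ` {js. length js = n \<and> set js \<subseteq> {1..6}}"
  proof -
    have "v \<in> X \<longleftrightarrow> (\<exists>js. length js = n \<and> set js \<subseteq> {1..6} \<and> v = sum_list (map m js))" for v
    proof -
      have "v \<in> X \<longleftrightarrow> (\<exists>bs\<in>lists (m ` {1..6}). length bs = n \<and> v = sum_list bs)"
        by (auto simp: X_def nested_configuration_def lists_eq_set)
      also have "\<dots> \<longleftrightarrow> (\<exists>js\<in>lists {1..6}. length js = n \<and> v = sum_list (map m js))"
        unfolding lists_image by auto
      finally show ?thesis
        by (auto simp: lists_eq_set)
    qed
    then show ?thesis
      by (auto simp: label_var_def)
  qed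
  also have "\<dots> = monomial ` mset ` {js. length js = n \<and> set js \<subseteq> {1..6}}"
    by (simp add: label_var_eq image_image)
  also have "mset ` {js. length js = n \<and> set js \<subseteq> {1..6}} = {M. label M}"
  proof -
    have "M \<in> mset ` {js. length js = n \<and> set js \<subseteq> {1..6}}" if "label M" for M
      using ex_mset[of M] that by (auto simp: label_def)
    then show ?thesis
      by (auto simp: label_def)
  qed
  finally show ?thesis .
qed

lemma finite_X: "finite X"
proof -
  have "X = sum_list ` {bs. set bs \<subseteq> m ` {1..6} \<and> length bs = n}"
    by (auto simp: X_def nested_configuration_def)
  then show ?thesis
    by (simp add: finite_lists_length_eq)
qed

text \<open>Replacing 1, 2, 3 by 4, 5, 6 keeps the monomial and removes three low letters. The
  strict decrease pays for type (ii) binomials that produce nonstandard labels.\<close>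

lemma ex_standard:
  assumes "label M"
  shows "\<exists>N. standard N \<and> monomial N = monomial M \<and> (N = M \<or> low_letters N < low_letters M)"
  using assms
proof (induction "low_letters M" arbitrary: M rule: less_induct)
  case less
  show ?case
  proof (cases "standard M")
    case False
    then have sub: "1 \<in># M" "2 \<in># M" "3 \<in># M"
      using less.prems by (auto simp: standard_def)
    define M0 where "M0 = M - {#1, 2, 3#}"
    have M: "M = {#1, 2, 3#} + M0"
      using sub unfolding M0_def by (auto simp: multiset_eq_iff)
    let ?M' = "{#4, 5, 6#} + M0"
    have "label ?M'"
      using less.prems by (simp add: M label_def)
    moreover have "low_letters ?M' < low_letters M"
      by (simp add: M low_letters_def)
    moreover have "monomial ?M' = monomial M"
      using arg_cong[OF relation, of "\<lambda>x. monomial M0 + x"] by (simp add: M monomial_def ac_simps)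
    ultimately show ?thesis
      using less.hyps[of ?M'] by (metis less_trans)
  qed auto
qed

definition std_label :: "nat mono \<Rightarrow> nat multiset" where
  "std_label v = (THE M. standard M \<and> monomial M = v)"

lemma std_label_eq: "standard M \<Longrightarrow> std_label (monomial M) = M"
  unfolding std_label_def
  by (rule the_equality) (auto simp: standard_def label_def monomial_def intro: standard_unique)

lemma std_label:
  assumes "v \<in> X"
  shows "standard (std_label v)" "monomial (std_label v) = v"
proof -
  obtain M where "label M" "v = monomial M"
    using assms by (auto simp: X_eq)
  then obtain N where "standard N" "v = monomial N"
    using ex_standard[of M] by metis
  then show "standard (std_label v)" "monomial (std_label v) = v"
    by (simp_all add: std_label_eq)
qed

lemma monomial_in_X: "label M \<Longrightarrow> monomial M \<in> X"
  by (simp add: X_eq)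

lemma standard_imp_label: "standard M \<Longrightarrow> label M"
  by (simp add: standard_def)

lemma inj_on_std_label: "inj_on std_label X"
  by (metis inj_onI std_label(2))

lemma low_letters_std_label:
  assumes "label M"
  shows "low_letters (std_label (monomial M)) \<le> low_letters M"
    and "\<not> standard M \<Longrightarrow> low_letters (std_label (monomial M)) < low_letters M"
proof -
  obtain N where N: "standard N" "monomial N = monomial M" "N = M \<or> low_letters N < low_letters M"
    using ex_standard[OF assms] by blast
  then have "std_label (monomial M) = N"
    using std_label_eq[of N] by simp
  then show "low_letters (std_label (monomial M)) \<le> low_letters M"
    and "\<not> standard M \<Longrightarrow> low_letters (std_label (monomial M)) < low_letters M"
    using N by auto
qed

lemma standard_mset_iff:
  "standard (mset L) \<longleftrightarrow> length L = n \<and> set L \<subseteq> {1..6} \<and> standard_label L"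
  by (auto simp: standard_def label_def standard_label_def)

lemma monomial_mono_eval:
  assumes "t \<in> monomials X"
  shows "monomial (mono_eval std_label t) = mono_eval (\<lambda>v. v) t"
  using assms
proof (induction t rule: mono_induct)
  case zero
  then show ?case
    by (simp add: monomial_def)
next
  case (add v t)
  then show ?case
    by (simp add: mono_eval_add monomial_add monomials_add_iff mono_var_in_monomials std_label(2))
qed

subsection \<open>The monomial order\<close>

text \<open>The lexicographic combination of three weights, encoded in one number: first the number of
  letters 1, 2, 3, then the squared number of ones, then the negated squared letter sum
  (made nonnegative by \<open>36 * n\<^sup>2\<close>, a bound for it).\<close>

definition weight :: "nat mono \<Rightarrow> nat" where
  "weight v = (let M = std_label v; D = 72 * n\<^sup>2 + 1 in
     D * (D * low_letters M + (count M 1)\<^sup>2) + (36 * n\<^sup>2 - (\<Sum>\<^sub># M)\<^sup>2))"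

lemma weight_pair_less:
  assumes "standard S" "standard T" "standard M" "standard N"
    and less: "low_letters S + low_letters T < low_letters M + low_letters N \<or>
      low_letters S + low_letters T = low_letters M + low_letters N \<and>
      ((count S 1)\<^sup>2 + (count T 1)\<^sup>2 < (count M 1)\<^sup>2 + (count N 1)\<^sup>2 \<or>
       (count S 1)\<^sup>2 + (count T 1)\<^sup>2 = (count M 1)\<^sup>2 + (count N 1)\<^sup>2 \<and>
       (\<Sum>\<^sub># M)\<^sup>2 + (\<Sum>\<^sub># N)\<^sup>2 < (\<Sum>\<^sub># S)\<^sup>2 + (\<Sum>\<^sub># T)\<^sup>2)"
  shows "weight (monomial S) + weight (monomial T) < weight (monomial M) + weight (monomial N)"
proof -
  \<comment> \<open>A letter sum is at most \<open>6 * n\<close>, so two values of \<open>r\<close>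
    add up to at most \<open>72 * n\<^sup>2\<close>, and two values of \<open>q\<close> to at most
    \<open>2 * n\<^sup>2\<close>. Hence a pair causes no carry in base \<open>D\<close>.\<close>
  define D where "D = 72 * n\<^sup>2 + 1"
  define q where "q M = (count M 1)\<^sup>2" for M :: "nat multiset"
  define r where "r M = 36 * n\<^sup>2 - (\<Sum>\<^sub># M)\<^sup>2" for M
  have weight: "weight (monomial A) = D * (D * low_letters A + q A) + r A" if "standard A" for A
    using std_label_eq[OF that] by (simp add: weight_def D_def q_def r_def Let_def)
  have sum_le: "(\<Sum>\<^sub># A)\<^sup>2 \<le> 36 * n\<^sup>2" and q_le: "q A \<le> n\<^sup>2" if "standard A" for A
  proof -
    have A: "size A = n" "\<And>x. x \<in># A \<Longrightarrow> x \<le> 6"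
      using that by (auto simp: standard_def label_def)
    then have "\<Sum>\<^sub># A \<le> 6 * n"
      using sum_mset_le_mult_size[of A 6] by auto
    then have "(\<Sum>\<^sub># A)\<^sup>2 \<le> (6 * n)\<^sup>2"
      by (rule power_mono) simp
    then show "(\<Sum>\<^sub># A)\<^sup>2 \<le> 36 * n\<^sup>2"
      by (simp add: power_mult_distrib)
    show "q A \<le> n\<^sup>2"
      unfolding q_def using count_le_size[of A 1] A by (intro power_mono) auto
  qed
  have "D * (D * (low_letters S + low_letters T) + (q S + q T)) + (r S + r T) <
      D * (D * (low_letters M + low_letters N) + (q M + q N)) + (r M + r N)"
  proof (rule lex_weight_less)
    show "r S + r T < D"
      by (simp add: r_def D_def)
    have "q S + q T < D"
      using q_le[OF assms(1)] q_le[OF assms(2)] by (simp add: D_def)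
    then have low: "D * (low_letters S + low_letters T) + (q S + q T) <
        D * (low_letters M + low_letters N) + (q M + q N)"
      if "low_letters S + low_letters T < low_letters M + low_letters N \<or>
        low_letters S + low_letters T = low_letters M + low_letters N \<and> q S + q T < q M + q N"
      using that by (intro lex_weight_less) auto
    \<comment> \<open>The bounds \<open>sum_le\<close> exclude truncation in \<open>r\<close>, so
      subtraction reverses the inequality.\<close>
    have "r S + r T < r M + r N"
      if "(\<Sum>\<^sub># M)\<^sup>2 + (\<Sum>\<^sub># N)\<^sup>2 < (\<Sum>\<^sub># S)\<^sup>2 + (\<Sum>\<^sub># T)\<^sup>2"
      using that sum_le[OF assms(1)] sum_le[OF assms(2)] sum_le[OF assms(3)] sum_le[OF assms(4)]
      unfolding r_def by linarith
    then show "D * (low_letters S + low_letters T) + (q S + q T) <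
          D * (low_letters M + low_letters N) + (q M + q N) \<or>
        D * (low_letters S + low_letters T) + (q S + q T) =
          D * (low_letters M + low_letters N) + (q M + q N) \<and> r S + r T < r M + r N"
      using less low unfolding q_def by auto
  qed
  then show ?thesis
    using assms(1-4) by (simp add: weight algebra_simps)
qed

end

context nested_labels
begin

subsection \<open>The binomials\<close>

text \<open>What both types have in common. \<open>S\<close> and \<open>T\<close> may be
  nonstandard, as happens in type (ii); the weight belongs to the variable and so sees its standard
  label.\<close>

definition reduction :: "nat mono mono \<Rightarrow> nat mono mono \<Rightarrow> bool" where
  "reduction s t \<longleftrightarrow> (\<exists>M N S T. standard M \<and> standard N \<and> label S \<and> label T \<and>
     s = mono_var (monomial M) + mono_var (monomial N) \<and>
     t = mono_var (monomial S) + mono_var (monomial T) \<and>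
     monomial M + monomial N = monomial S + monomial T \<and>
     weight (monomial S) + weight (monomial T) < weight (monomial M) + weight (monomial N))"

lemma label_mono_eq: "label_mono m L = mono_var (monomial (mset L))"
  by (simp add: label_mono_def label_var_eq)

text \<open>The new labels are again standard: the first one lacks \<open>j3\<close>, and the second
  contains no low letter that was not there before. So the loss of 1, 2, 3 is visible in the
  weight.\<close>

lemma reduction_binomials_i:
  assumes "(s, t) \<in> binomials_i n m"
  shows "reduction s t"
proof -
  obtain j1 j2 j3 j4 j5 j6 M1 M2 where
    s: "s = label_mono m ([j1, j2] @ M1) + label_mono m (j3 # M2)" and
    t: "t = label_mono m ([j4, j5] @ M1) + label_mono m (j6 # M2)" and
    j: "{j1, j2, j3} = {1, 2, 3}" "{j4, j5, j6} = {4, 5, 6}" and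
    len: "length M1 = n - 2" "length M2 = n - 1" and
    sub: "set M1 \<subseteq> {1..6}" "set M2 \<subseteq> {1..6}" and
    std: "standard_label ([j1, j2] @ M1)" "standard_label (j3 # M2)"
    using assms unfolding binomials_i_def by blast
  have j123: "{#j1, j2, j3#} = {#1, 2, 3#}" and j456: "{#j4, j5, j6#} = {#4, 5, 6#}"
    using j by (intro mset_triple_eq; simp)+
  have mem: "j1 \<in> {1, 2, 3}" "j2 \<in> {1, 2, 3}" "j3 \<in> {1, 2, 3}"
      "j4 \<in> {4, 5, 6}" "j5 \<in> {4, 5, 6}" "j6 \<in> {4, 5, 6}"
    using j by blast+
  have "{1, 2, 3} \<subseteq> {1..6 :: nat}" "{4, 5, 6} \<subseteq> {1..6 :: nat}"
    by auto
  with mem have range: "j1 \<in> {1..6}" "j2 \<in> {1..6}" "j3 \<in> {1..6}"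
      "j4 \<in> {1..6}" "j5 \<in> {1..6}" "j6 \<in> {1..6}"
    by blast+
  let ?M = "mset ([j1, j2] @ M1)" and ?N = "mset (j3 # M2)"
  let ?S = "mset ([j4, j5] @ M1)" and ?T = "mset (j6 # M2)"
  have M: "standard ?M" and N: "standard ?N"
    using std len sub n_gt_1 range unfolding standard_mset_iff by auto
  have S_label: "label ?S" and T_label: "label ?T"
    using len sub n_gt_1 range by (auto simp: label_def)
  have "j3 \<notin> set M1"
    using j(1) std(1) by (auto simp: standard_label_def)
  moreover have "j3 \<noteq> j4" "j3 \<noteq> j5"
    using mem(3-5) by force+
  ultimately have "j3 \<notin># ?S"
    by simp
  then have S: "standard ?S"
    using S_label mem(3) by (auto simp: standard_def)
  have "set_mset ?T \<inter> {1, 2, 3} \<subseteq> set_mset ?N"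
    using mem(6) by auto
  then have T: "standard ?T"
    using T_label N unfolding standard_def by blast
  have MN: "?M + ?N = {#1, 2, 3#} + mset M1 + mset M2"
    unfolding j123[symmetric] by simp
  have ST: "?S + ?T = {#4, 5, 6#} + mset M1 + mset M2"
    unfolding j456[symmetric] by simp
  have "low_letters ?S + low_letters ?T < low_letters ?M + low_letters ?N"
    unfolding low_letters_add[symmetric] MN ST by (simp add: low_letters_def)
  then have "weight (monomial ?S) + weight (monomial ?T) < weight (monomial ?M) + weight (monomial ?N)"
    by (intro weight_pair_less S T M N disjI1)
  moreover have "monomial ?M + monomial ?N = monomial ?S + monomial ?T"
    using relation unfolding monomial_add[symmetric] MN ST by (simp add: monomial_def flip: add.assoc)
  ultimately show ?thesis
    unfolding reduction_def s t label_mono_eq using M N S_label T_label by blast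
qed

lemma reduction_binomials_ii:
  assumes "(s, t) \<in> binomials_ii n m"
  shows "reduction s t"
proof -
  obtain L1 L2 J \<alpha> where "s \<noteq> t" and
    len: "length L1 = n" "length L2 = n" and
    sub: "set L1 \<subseteq> {1..6}" "set L2 \<subseteq> {1..6}" and
    std: "standard_label L1" "standard_label L2" and
    \<alpha>: "1 \<le> \<alpha>" "\<alpha> \<le> n" and lenJ: "length J = 2 * \<alpha>" and
    sort: "sort (L1 @ L2) = replicate (2 * (n - \<alpha>)) 1 @ J" and J: "J ! 1 > 1" and
    s: "s = label_mono m L1 + label_mono m L2" and
    t: "t = label_mono m (replicate (n - \<alpha>) 1 @ take \<alpha> J) +
            label_mono m (replicate (n - \<alpha>) 1 @ drop \<alpha> J)"
    using assms unfolding binomials_ii_def by blast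
  let ?M = "mset L1" and ?N = "mset L2"
  let ?S = "mset (replicate (n - \<alpha>) 1 @ take \<alpha> J)"
  let ?T = "mset (replicate (n - \<alpha>) 1 @ drop \<alpha> J)"
  have MN: "?M + ?N = ?S + ?T"
    using mset_split_sort[OF sort] .
  have M: "standard ?M" and N: "standard ?N"
    using std len sub unfolding standard_mset_iff by auto
  have "set_mset ?S \<union> set_mset ?T = set L1 \<union> set L2"
    using arg_cong[OF MN, of set_mset] by simp
  then have labels: "label ?S" "label ?T"
    using \<alpha> lenJ sub unfolding label_def by auto
  have low: "low_letters ?M + low_letters ?N = low_letters ?S + low_letters ?T"
    using MN by (metis low_letters_add)
  have "weight (monomial ?S) + weight (monomial ?T) < weight (monomial ?M) + weight (monomial ?N)"
  proof (cases "standard ?S \<and> standard ?T")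
    case True
    have zero: "0 \<notin> set L1 \<union> set L2"
      using sub by auto
    have "0 \<notin> set J"
      using zero arg_cong[OF sort, of set] by auto
    moreover have "sorted (replicate (2 * (n - \<alpha>)) 1 @ J)"
      using sorted_sort[of "L1 @ L2"] unfolding sort .
    ultimately have bal: "balanced ?S ?T"
      using \<alpha> lenJ J by (intro balanced_split)
    have size: "size ?M = n" "size ?N = n" "size ?S = n" "size ?T = n"
      using len labels by (simp_all only: size_mset label_def)
    have "0 \<notin># ?T"
      using labels by (auto simp: label_def)
    moreover have "\<not> (?M = ?S \<and> ?N = ?T)" "\<not> (?M = ?T \<and> ?N = ?S)"
      using \<open>s \<noteq> t\<close> unfolding s t label_mono_eq by (metis add.commute)+
    ultimately show ?thesis
      using balanced_weights[OF MN size _ bal] low True M N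
      by (intro weight_pair_less) auto
  next
    case False
    \<comment> \<open>Passing to standard labels never adds low letters and strictly removes some
      from a nonstandard label.\<close>
    then have "low_letters (std_label (monomial ?S)) + low_letters (std_label (monomial ?T)) <
        low_letters ?M + low_letters ?N"
      using low low_letters_std_label[OF labels(1)] low_letters_std_label[OF labels(2)] by linarith
    moreover obtain S' T' where "standard S'" "monomial S' = monomial ?S"
        "standard T'" "monomial T' = monomial ?T"
      using ex_standard labels by metis
    ultimately show ?thesis
      using weight_pair_less[of S' T' ?M ?N] M N std_label_eq[of S'] std_label_eq[of T'] by auto
  qed
  moreover have "monomial ?M + monomial ?N = monomial ?S + monomial ?T"
    using MN by (metis monomial_add)
  ultimately show ?thesis
    unfolding reduction_def s t label_mono_eq using M N labels by blast
qed

lemma ex_binomial_i: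
  assumes "standard A" "standard B" "j1 \<in># A" "j2 \<in># A" "j3 \<in># B" "{j1, j2, j3} = {1, 2, 3}"
  shows "\<exists>t. (mono_var (monomial A) + mono_var (monomial B), t) \<in> binomials_i n m"
proof -
  have "distinct [j1, j2, j3]"
  proof (rule card_distinct)
    have "set [j1, j2, j3] = {1, 2, 3}"
      using assms(6) by simp
    then show "card (set [j1, j2, j3]) = length [j1, j2, j3]"
      by simp
  qed
  then have "j2 \<in># A - {#j1#}"
    using assms(4) by (simp add: in_diff_count)
  then obtain A' where A': "A = add_mset j1 (add_mset j2 A')"
    using assms(3) by (metis insert_DiffM)
  obtain B' where B': "B = add_mset j3 B'"
    using assms(5) by (metis insert_DiffM)
  obtain M1 M2 where "mset M1 = A'" "mset M2 = B'"
    using ex_mset by metis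
  then have A: "A = mset ([j1, j2] @ M1)" and B: "B = mset (j3 # M2)"
    using A' B' by simp_all
  \<comment> \<open>Any distribution of 4, 5, 6 would do, since only the first monomial is
    prescribed.\<close>
  let ?t = "label_mono m ([4, 5] @ M1) + label_mono m (6 # M2)"
  have "length M1 = n - 2" "length M2 = n - 1" "set M1 \<subseteq> {1..6}" "set M2 \<subseteq> {1..6}"
      "standard_label ([j1, j2] @ M1)" "standard_label (j3 # M2)"
    using assms(1,2) unfolding A B standard_mset_iff by auto
  then have "(label_mono m ([j1, j2] @ M1) + label_mono m (j3 # M2), ?t) \<in> binomials_i n m"
    using assms(6) unfolding binomials_i_def by blast
  then show ?thesis
    unfolding A B label_mono_eq by blast
qed

text \<open>By the pigeonhole principle one label holds two of the letters 1, 2, 3; being standard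
  it lacks the third, which the other label must supply.\<close>

lemma ex_binomial_i_pair:
  assumes "standard A" "standard B" "{1, 2, 3} \<subseteq> set_mset (A + B)"
  shows "\<exists>t. (mono_var (monomial A) + mono_var (monomial B), t) \<in> binomials_i n m"
proof -
  have "\<exists>j1 j2 j3. {j1, j2, j3} = {1, 2, 3 :: nat} \<and>
      (j1 \<in># A \<and> j2 \<in># A \<and> j3 \<in># B \<or> j1 \<in># B \<and> j2 \<in># B \<and> j3 \<in># A)"
  proof -
    have sets: "{1, 2, 3} = {1, 2, 3 :: nat}" "{1, 3, 2} = {1, 2, 3 :: nat}" "{2, 3, 1} = {1, 2, 3 :: nat}"
      by auto
    have "1 \<in># A \<or> 1 \<in># B" "2 \<in># A \<or> 2 \<in># B" "3 \<in># A \<or> 3 \<in># B"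
        "\<not> (1 \<in># A \<and> 2 \<in># A \<and> 3 \<in># A)" "\<not> (1 \<in># B \<and> 2 \<in># B \<and> 3 \<in># B)"
      using assms by (auto simp: standard_def)
    then show ?thesis
      using sets by metis
  qed
  then show ?thesis
    using ex_binomial_i[OF assms(1,2)] ex_binomial_i[OF assms(2,1)] by (metis add.commute)
qed

text \<open>The sorted split is balanced, so it differs from the given pair. It inherits the absence
  of 1, 2 or 3 and is standard, so different multisets give different variables and the binomial is
  not discarded.\<close>

lemma ex_binomial_ii:
  assumes "standard A" "standard B" "\<not> {1, 2, 3} \<subseteq> set_mset (A + B)"
    and "\<not> balanced A B" "\<not> balanced B A"
  shows "\<exists>t. (mono_var (monomial A) + mono_var (monomial B), t) \<in> binomials_ii n m"
proof -
  obtain L1 L2 where A: "A = mset L1" and B: "B = mset L2"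
    using ex_mset by metis
  have L: "length L1 = n" "set L1 \<subseteq> {1..6}" "standard_label L1"
      "length L2 = n" "set L2 \<subseteq> {1..6}" "standard_label L2"
    using assms(1,2) unfolding A B standard_mset_iff by auto
  have size: "size A = n" "size B = n"
    using L A B by simp_all
  let ?xs = "sort (L1 @ L2)"
  have mset_xs: "mset ?xs = A + B"
    by (simp add: A B)
  have zero: "0 \<notin> set ?xs"
    using L by auto
  have "count (mset ?xs) 1 < 2 * n"
  proof (rule ccontr)
    assume "\<not> ?thesis"
    then have "2 * n \<le> count A 1 + count B 1"
      unfolding mset_xs by simp
    then have "count A 1 = n" "count B 1 = n"
      using count_le_size[of A 1] count_le_size[of B 1] size by simp_all
    then have "nonones A = {#}" "nonones B = {#}"
      using size size_nonones[of A] size_nonones[of B] by simp_all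
    then show False
      using assms(4) \<open>count A 1 = n\<close> \<open>count B 1 = n\<close> by (simp add: balanced_def)
  qed
  then obtain \<alpha> J where \<alpha>: "1 \<le> \<alpha>" "\<alpha> \<le> n" and J: "length J = 2 * \<alpha>"
      "?xs = replicate (2 * (n - \<alpha>)) 1 @ J" "J ! 1 > 1"
    using split_ones[of ?xs n] zero L by auto
  let ?T1 = "replicate (n - \<alpha>) 1 @ take \<alpha> J" and ?T2 = "replicate (n - \<alpha>) 1 @ drop \<alpha> J"
  have T: "mset L1 + mset L2 = mset ?T1 + mset ?T2"
    using mset_split_sort[OF J(2)] .
  have sets: "set_mset (mset ?T1) \<subseteq> set_mset (A + B)" "set_mset (mset ?T2) \<subseteq> set_mset (A + B)"
    unfolding A B T by auto
  then have sub: "set ?T1 \<subseteq> {1..6}" "set ?T2 \<subseteq> {1..6}"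
      "\<not> {1, 2, 3} \<subseteq> set ?T1" "\<not> {1, 2, 3} \<subseteq> set ?T2"
    using L(2,5) assms(3) unfolding A B set_mset_union set_mset_mset by blast+
  have std: "standard (mset ?T1)" "standard (mset ?T2)"
    using sub \<alpha> J(1) unfolding standard_mset_iff standard_label_def by auto
  have "0 \<notin> set J"
    using zero J(2) by (metis UnCI set_append)
  moreover have "sorted (replicate (2 * (n - \<alpha>)) 1 @ J)"
    using sorted_sort[of "L1 @ L2"] unfolding J(2) .
  ultimately have bal: "balanced (mset ?T1) (mset ?T2)"
    using \<alpha> J by (intro balanced_split)
  let ?s = "label_mono m L1 + label_mono m L2" and ?t = "label_mono m ?T1 + label_mono m ?T2"
  have "?s \<noteq> ?t"
  proof
    assume "?s = ?t"
    then have "A = mset ?T1 \<and> B = mset ?T2 \<or> A = mset ?T2 \<and> B = mset ?T1"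
      using std assms(1,2) std_label_eq unfolding label_mono_eq mono_var_add_eq_iff A B by metis
    then show False
      using bal assms(4,5) by metis
  qed
  then have "(?s, ?t) \<in> binomials_ii n m"
    using L \<alpha> J unfolding binomials_ii_def by blast
  then show ?thesis
    unfolding A B label_mono_eq by blast
qed

lemma reductionD:
  assumes "reduction s t"
  shows "s \<in> monomials X" "t \<in> monomials X" "mono_eval (\<lambda>v. v) s = mono_eval (\<lambda>v. v) t"
    "mono_eval weight t < mono_eval weight s" "mono_degree s = 2"
  using assms unfolding reduction_def
  by (auto simp: monomials_add_iff mono_var_in_monomials monomial_in_X standard_imp_label
      mono_eval_add mono_degree_eq_mono_eval)

lemma reduction_P: "(s, t) \<in> P \<Longrightarrow> reduction s t"
  using reduction_binomials_i reduction_binomials_ii by blast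

lemma finite_P: "finite P"
proof -
  let ?Q = "(\<lambda>(v, w). mono_var v + mono_var w) ` (X \<times> X)"
  have "P \<subseteq> ?Q \<times> ?Q"
  proof clarify
    fix s t assume "(s, t) \<in> P"
    then have "reduction s t"
      by (rule reduction_P)
    moreover have "mono_var (monomial M) + mono_var (monomial N) \<in> ?Q" if "label M" "label N" for M N
      using that by (intro image_eqI[of _ _ "(monomial M, monomial N)"]) (simp_all add: monomial_in_X)
    ultimately show "s \<in> ?Q \<and> t \<in> ?Q"
      unfolding reduction_def using standard_imp_label by blast
  qed
  then show ?thesis
    using finite_X by (meson finite_SigmaI finite_imageI finite_subset)
qed

section \<open>Uniqueness of irreducible monomials\<close>

lemma irreducible_pair:
  assumes "irreducible_mono P t" "t \<in> monomials X" "t = mono_var v + (mono_var w + u)"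
  shows "\<not> {1, 2, 3} \<subseteq> set_mset (std_label v + std_label w)"
    and "balanced (std_label v) (std_label w) \<or> balanced (std_label w) (std_label v)"
proof -
  have vw: "v \<in> X" "w \<in> X"
    using assms(2,3) by (auto simp: monomials_add_iff mono_var_in_monomials)
  have irr: "(mono_var v + mono_var w, b) \<notin> P" for b
    using assms(1) unfolding assms(3) add.assoc[symmetric] by (rule irreducible_monoD)
  show not: "\<not> {1, 2, 3} \<subseteq> set_mset (std_label v + std_label w)"
    using ex_binomial_i_pair[of "std_label v" "std_label w"] irr vw std_label by auto
  show "balanced (std_label v) (std_label w) \<or> balanced (std_label w) (std_label v)"
    using ex_binomial_ii[of "std_label v" "std_label w"] not irr vw std_label by auto
qed

lemma irreducible_unique:
  assumes s: "s \<in> monomials X" "irreducible_mono P s" and t: "t \<in> monomials X" "irreducible_mono P t"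
    and eq: "mono_eval (\<lambda>v. v) s = mono_eval (\<lambda>v. v) t"
  shows "s = t"
proof (rule pairwise_balanced_unique[OF inj_on_std_label])
  show "n > 0"
    using n_gt_1 by simp
  show size: "size (std_label v) = n" if "v \<in> X" for v
    using std_label(1)[OF that] by (simp add: standard_def label_def)
  have balanced: "pairwise_balanced std_label u" if "u \<in> monomials X" "irreducible_mono P u" for u
    using irreducible_pair(2)[OF that(2,1)] by (auto simp: pairwise_balanced_def)
  show "pairwise_balanced std_label s" "pairwise_balanced std_label t"
    using s t balanced by auto
  have "set_mset (mono_eval std_label u) \<subseteq> {1..6} \<and> \<not> {1, 2, 3} \<subseteq> set_mset (mono_eval std_label u)"
    if u: "u \<in> monomials X" "irreducible_mono P u" for u
  proof
    have keys: "v \<in> X" if "v \<in> Poly_Mapping.keys u" for v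
      using that u(1) by (auto simp: monomials_def)
    then have std: "standard (std_label v)" if "v \<in> Poly_Mapping.keys u" for v
      using that std_label(1) by blast
    then show "set_mset (mono_eval std_label u) \<subseteq> {1..6}"
      by (force simp: in_mono_eval_iff standard_def label_def)
    show "\<not> {1, 2, 3} \<subseteq> set_mset (mono_eval std_label u)"
    proof (rule pairwise_balanced_avoids_123[OF balanced[OF u] n_gt_1])
      show "0 \<notin># std_label v" if "v \<in> Poly_Mapping.keys u" for v
        using std[OF that] by (auto simp: standard_def label_def)
      show "\<not> {1, 2, 3} \<subseteq> set_mset (std_label v)" if "v \<in> Poly_Mapping.keys u" for v
        using std[OF that] unfolding standard_def by blast
    qed (use keys size irreducible_pair(1)[OF u(2,1)] in blast)+
  qed
  moreover have "\<Sum>\<^sub># (image_mset m (mono_eval std_label s)) = \<Sum>\<^sub># (image_mset m (mono_eval std_label t))"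
    using s t eq monomial_mono_eval[of s] monomial_mono_eval[of t] by (simp add: monomial_def)
  ultimately show "mono_eval std_label s = mono_eval std_label t"
    using s t by (intro standard_unique) auto
qed (use s t in auto)

end

subsection \<open>The toric ideal of the base configuration\<close>

lemma mono_eval_sum_mset: "mono_eval f (\<Sum>\<^sub># (image_mset mono_var M)) = \<Sum>\<^sub># (image_mset f M)"
  by (induction M) (simp_all add: mono_eval_add)

lemma sum_mset_mono_var_in_monomials:
  "set_mset M \<subseteq> X \<Longrightarrow> \<Sum>\<^sub># (image_mset mono_var M) \<in> monomials X"
  by (induction M) (simp_all add: monomials_add_iff mono_var_in_monomials, simp add: monomials_def)

text \<open>Under this map two exponent vectors have the same image iff they differ by a multiple of
  \<open>(1, 1, 1, -1, -1, -1)\<close>.\<close>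

definition test_map :: "nat \<Rightarrow> nat mono" where
  "test_map i =
    (if i = 1 then mono_var 0 + mono_var 1 + mono_var 2
     else if i = 2 then mono_var 3
     else if i = 3 then mono_var 4
     else if i = 4 then mono_var 0 + mono_var 3 + mono_var 4
     else if i = 5 then mono_var 1
     else mono_var 2)"

lemma lookup_test_map:
  assumes "set_mset M \<subseteq> {1..6}"
  defines "l \<equiv> Poly_Mapping.lookup (\<Sum>\<^sub># (image_mset test_map M))"
  shows "l 0 = count M 1 + count M 4 \<and> l 1 = count M 1 + count M 5 \<and> l 2 = count M 1 + count M 6 \<and>
    l 3 = count M 2 + count M 4 \<and> l 4 = count M 3 + count M 4"
  using assms(1) unfolding l_def
proof (induction M)
  case (add x M)
  then have "x \<in> {1..6}"
    by simp
  then have "x = 1 \<or> x = 2 \<or> x = 3 \<or> x = 4 \<or> x = 5 \<or> x = 6"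
    by auto
  then show ?case
    using add by (elim disjE) (simp_all add: lookup_add test_map_def mono_var_def lookup_single lookup_one)
qed simp

text \<open>The five equations leave only a shift of 1, 2, 3 against 4, 5, 6; a nonzero shift would
  put all of 1, 2, 3 into one of the two multisets.\<close>

lemma test_map_unique:
  assumes "set_mset M \<subseteq> {1..6}" "set_mset N \<subseteq> {1..6}"
    and "\<not> {1, 2, 3} \<subseteq> set_mset M" "\<not> {1, 2, 3} \<subseteq> set_mset N"
    and eq: "\<Sum>\<^sub># (image_mset test_map M) = \<Sum>\<^sub># (image_mset test_map N)"
  shows "M = N"
proof -
  have sums: "count M 1 + count M 4 = count N 1 + count N 4"
    "count M 1 + count M 5 = count N 1 + count N 5"
    "count M 1 + count M 6 = count N 1 + count N 6"
    "count M 2 + count M 4 = count N 2 + count N 4"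
    "count M 3 + count M 4 = count N 3 + count N 4"
    using lookup_test_map[OF assms(1)] lookup_test_map[OF assms(2)] eq by simp_all
  have zero: "count M 1 = 0 \<or> count M 2 = 0 \<or> count M 3 = 0"
    "count N 1 = 0 \<or> count N 2 = 0 \<or> count N 3 = 0"
    using assms(3,4) by (auto simp: count_eq_zero_iff)
  have counts: "count M 1 = count N 1" "count M 2 = count N 2" "count M 3 = count N 3"
      "count M 4 = count N 4" "count M 5 = count N 5" "count M 6 = count N 6"
    using sums zero by linarith+
  show ?thesis
  proof (rule multiset_eqI)
    fix x
    show "count M x = count N x"
    proof (cases "x \<in> {1..6}")
      case True
      then have "x = 1 \<or> x = 2 \<or> x = 3 \<or> x = 4 \<or> x = 5 \<or> x = 6"
        by auto
      then show ?thesis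
        using counts by auto
    next
      case False
      then have "x \<notin># M" "x \<notin># N"
        using assms(1,2) by blast+
      then show ?thesis
        by (simp add: not_in_iff)
    qed
  qed
qed

text \<open>The ideal is known by its generator, which \<open>test_map\<close> kills. So monomials
  identified by \<open>m\<close> are identified by \<open>test_map\<close>, whose fibres are
  explicit; this replaces a division by the generator.\<close>

lemma nested_labels_if_toric_ideal:
  fixes m :: "nat \<Rightarrow> nat mono"
  assumes "n > 1"
    and ideal: "toric_ideal U {1..6} m =
      Idl\<^bsub>poly_ring {1..6}\<^esub> {var 1 * var 2 * var 3 - var 4 * var 5 * var 6 :: (nat, 'k::field) mpoly}"
  shows "nested_labels n m"
proof
  let ?a = "mono_var 1 + mono_var 2 + mono_var 3 :: nat mono"
  let ?b = "mono_var 4 + mono_var 5 + mono_var 6 :: nat mono"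
  let ?g = "mono_poly ?a - mono_poly ?b :: (nat, 'k) mpoly"
  interpret cring "poly_ring {1..6} :: (nat, 'k) mpoly ring"
    by (rule cring_poly_ring)
  have g: "var 1 * var 2 * var 3 - var 4 * var 5 * var 6 = ?g"
    by (simp add: var_def mono_poly_add)
  have "?a \<in> monomials {1..6}" "?b \<in> monomials {1..6}"
    by (simp_all add: monomials_add_iff mono_var_in_monomials)
  then have keys_g: "Poly_Mapping.keys ?g \<subseteq> monomials {1..6}"
    using keys_diff[of "mono_poly ?a :: (nat, 'k) mpoly" "mono_poly ?b"]
    by (auto simp: keys_mono_poly)
  have "?g \<in> toric_ideal U {1..6} m"
    unfolding ideal g using keys_g by (intro genideal_self') (simp add: carrier_poly_ring)
  then show "m 1 + m 2 + m 3 = m 4 + m 5 + m 6"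
    by (simp add: mem_toric_ideal_iff push_poly_binomial_eq_0_iff mono_eval_add)
  have "push_poly test_map ?g = 0"
    by (simp add: push_poly_binomial_eq_0_iff mono_eval_add test_map_def ac_simps)
  note push = push_poly_Idl_single[OF _ keys_g this]
  fix M N
  assume MN: "set_mset M \<subseteq> {1..6}" "set_mset N \<subseteq> {1..6}"
      "\<not> {1, 2, 3} \<subseteq> set_mset M" "\<not> {1, 2, 3} \<subseteq> set_mset N"
      "\<Sum>\<^sub># (image_mset m M) = \<Sum>\<^sub># (image_mset m N)"
  let ?c = "\<Sum>\<^sub># (image_mset mono_var M)" and ?d = "\<Sum>\<^sub># (image_mset mono_var N)"
  let ?h = "mono_poly ?c - mono_poly ?d :: (nat, 'k) mpoly"
  have "?c \<in> monomials {1..6}" "?d \<in> monomials {1..6}"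
    using MN by (simp_all add: sum_mset_mono_var_in_monomials)
  then have "Poly_Mapping.keys ?h \<subseteq> monomials {1..6}"
    using keys_diff[of "mono_poly ?c :: (nat, 'k) mpoly" "mono_poly ?d"]
    by (auto simp: keys_mono_poly)
  then have "?h \<in> toric_ideal U {1..6} m"
    using MN(5) by (simp add: mem_toric_ideal_iff push_poly_binomial_eq_0_iff mono_eval_sum_mset)
  then have "push_poly test_map ?h = 0"
    unfolding ideal g by (rule push)
  then show "M = N"
    using MN by (intro test_map_unique) (auto simp: push_poly_binomial_eq_0_iff mono_eval_sum_mset)
qed (fact assms(1))

theorem theorem3p4:
  fixes n \<mu> :: nat and m :: "nat \<Rightarrow> nat mono"
  assumes "n > 1"
    and "configuration \<mu> (m ` {1..6})" and "inj_on m {1..6}"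
    and "toric_ideal {1..\<mu>} {1..6} m =
      Idl\<^bsub>poly_ring {1..6}\<^esub> {var 1 * var 2 * var 3 - var 4 * var 5 * var 6 :: (nat, 'k::field) mpoly}"
  shows "let X = nested_configuration n (m ` {1..6});
             P = binomials_i n m \<union> binomials_ii n m
         in \<exists>r. monomial_order X r \<and>
              quadratic_groebner_basis X r (toric_ideal {1..\<mu>} X (\<lambda>v. v))
                (binomial_poly ` P :: (nat mono, 'k) mpoly set) \<and>
              (\<forall>(s, t)\<in>P. initial_mono r (binomial_poly (s, t) :: (nat mono, 'k) mpoly) = s)"
proof -
  interpret nested_labels n m
    by (rule nested_labels_if_toric_ideal[OF assms(1,4)])
  let ?r = "weight_order X weight"
  have "groebner_basis X ?r (toric_ideal {1..\<mu>} X (\<lambda>v. v)) (binomial_poly ` P :: (nat mono, 'k) mpoly set)"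
    and initial: "\<And>s t. (s, t) \<in> P \<Longrightarrow>
      initial_mono ?r (binomial_poly (s, t) :: (nat mono, 'k) mpoly) = s"
    using reductionD(1-4)[OF reduction_P] irreducible_unique
    by (intro groebner_basis_toric_ideal[OF finite_P]; blast)+
  moreover have "mono_degree (initial_mono ?r g) = 2"
    if g_in: "g \<in> binomial_poly ` P" for g :: "(nat mono, 'k) mpoly"
  proof -
    obtain p where "g = binomial_poly p" "p \<in> P"
      by (rule imageE[OF g_in])
    then obtain s t where st: "(s, t) \<in> P" and g: "g = binomial_poly (s, t)"
      by (cases p) blast
    show ?thesis
      unfolding g initial[OF st] by (rule reductionD(5)[OF reduction_P[OF st]])
  qed
  ultimately have "monomial_order X ?r \<and>
      quadratic_groebner_basis X ?r (toric_ideal {1..\<mu>} X (\<lambda>v. v))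
        (binomial_poly ` P :: (nat mono, 'k) mpoly set) \<and>
      (\<forall>(s, t)\<in>P. initial_mono ?r (binomial_poly (s, t) :: (nat mono, 'k) mpoly) = s)"
    using monomial_order_weight_order by (auto simp: quadratic_groebner_basis_def)
  then show ?thesis
    unfolding Let_def X_def by blast
qed

end
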